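(* Let $k \ge 3$ be an integer. Let $\lambda_2(\mathcal{L}(P_{2k,k}))$, $\lambda_2(\mathcal{L}(P_{4k}))$ and $\lambda_2(\mathcal{L}(R_{2k,k}))$ denote the second smallest eigenvalues of $\mathcal{L}(P_{2k,k})$, $\mathcal{L}(P_{4k})$ and $\mathcal{L}(R_{2k,k})$ respectively. Then: (1) $\lambda_2(\mathcal{L}(P_{4k})) < \lambda_2(\mathcal{L}(P_{2k,k}))$; (2) $\lambda_2(\mathcal{L}(R_{2k,k})) < \lambda_2(\mathcal{L}(P_{4k}))$; (3) every eigenvector $U$ of $\mathcal{L}(R_{2k,k})$ for the eigenvalue $\lambda_2(\mathcal{L}(R_{2k,k}))$ is an odd vector, i.e. $U(y_i) = -U(x_i)$ for all $1\le i\le 3k$; (4) the eigenvalue $\lambda_2(\mathcal{L}(R_{2k,k}))$ is simple; (5) $Mcut(R_{2k,k}) < Lcut(R_{2k,k})$, i.e. for every eigenvector $U$ of $\mathcal{L}(R_{2k,k})$ for $\lambda_2(\mathcal{L}(R_{2k,k}))$ one has $Mcut(R_{2k,k}) < Ncut(V^+(U)\cup V^0(U), V^-(U))$.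
   Context: Graphs are finite, undirected, with a symmetric nonnegative weight matrix $W=(w_{ij})$ (possibly with loops $w_{ii}>0$). The degree is $d_i=\sum_j w_{ij}$, $D=\mathrm{diag}(d_i)$, and the normalized Laplacian is $\mathcal{L}(G)=I-D^{-1/2}WD^{-1/2}$, i.e. $\ell_{ii}=1-w_{ii}/d_i$ and $\ell_{ij}=-w_{ij}/\sqrt{d_id_j}$ for $i\ne j$. For $A\subseteq V$, $vol(A)=\sum_{i\in A}d_i$; for disjoint $A,B$, $cut(A,B)=\sum_{i\in A,j\in B}w_{ij}$; $Ncut(A,B)=cut(A,B)\left(\frac{1}{vol(A)}+\frac{1}{vol(B)}\right)$; $Mcut(G)=\min\{Ncut(A,V\setminus A): \emptyset\ne A\subsetneq V\}$. For a vector $U$ indexed by $V$, $V^+(U)=\{v: U(v)>0\}$, $V^-(U)=\{v:U(v)<0\}$, $V^0(U)=\{v:U(v)=0\}$. $P_m$ is the unweighted path on $m$ vertices. $P_{n,k}$ ($n,k\ge1$) is the weighted graph on vertices $x_1,\dots,x_{n+k}$ with edges $x_ix_{i+1}$ ($1\le i<n+k$) of weight 1 and a loop of weight 1 at each $x_i$ with $n+1\le i\le n+k$ (a loop contributes 1 to the degree). $R_{n,k}$ ($n\ge1,k\ge2$) is the unweighted graph on vertices $x_1,\dots,x_{n+k},y_1,\dots,y_{n+k}$ with edges $x_ix_{i+1}$ and $y_iy_{i+1}$ for $1\le i\le n+k-1$, and $x_iy_i$ for $n+1\le i\le n+k$. *)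

theory Defs
  imports Complex_Main "Jordan_Normal_Form.Char_Poly"
begin

text \<open>
  A weighted graph on the vertex set \<open>{0..<N}\<close> is given by its symmetric nonnegative
  \<open>N \<times> N\<close> weight matrix; diagonal entries are the weights of loops.
\<close>

definition weight_matrix :: "real mat \<Rightarrow> bool" where
  "weight_matrix W \<longleftrightarrow> W \<in> carrier_mat (dim_row W) (dim_row W) \<and>
     (\<forall>i<dim_row W. \<forall>j<dim_row W. W $$ (i, j) = W $$ (j, i) \<and> 0 \<le> W $$ (i, j))"

definition verts :: "real mat \<Rightarrow> nat set" where
  "verts W = {0..<dim_row W}"

definition wdegree :: "real mat \<Rightarrow> nat \<Rightarrow> real" where
  "wdegree W i = (\<Sum>j\<in>verts W. W $$ (i, j))"

definition normalized_laplacian :: "real mat \<Rightarrow> real mat" where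
  "normalized_laplacian W =
     (let N = dim_row W; S = mat_diag N (\<lambda>i. 1 / sqrt (wdegree W i))
      in 1\<^sub>m N - S * W * S)"

lemma normalized_laplacian_dims [simp]:
  assumes "W \<in> carrier_mat N N"
  shows "normalized_laplacian W \<in> carrier_mat N N"
  using assms unfolding normalized_laplacian_def Let_def by (auto simp: mat_diag_def)

lemma normalized_laplacian_entry:
  assumes "weight_matrix W" "i < dim_row W" "j < dim_row W"
  shows "normalized_laplacian W $$ (i, j) =
    (if i = j then 1 - W $$ (i, i) / wdegree W i
     else - W $$ (i, j) / sqrt (wdegree W i * wdegree W j))"
proof -
  define N where "N = dim_row W"
  define s where "s i = 1 / sqrt (wdegree W i)" for i
  have W: "W \<in> carrier_mat N N" and ij: "i < N" "j < N"
    using assms by (simp_all add: weight_matrix_def N_def)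
  have "0 \<le> W $$ (i, l)" if "l \<in> verts W" for l
    using assms that unfolding weight_matrix_def verts_def by simp
  then have nonneg: "0 \<le> wdegree W i"
    unfolding wdegree_def by (rule sum_nonneg)
  have L: "mat_diag N s * W = Matrix.mat N N (\<lambda>(i, j). s i * W $$ (i, j))"
    by (rule mat_diag_mult_left[OF W])
  have R: "mat_diag N s * W * mat_diag N s =
      Matrix.mat N N (\<lambda>(i, j). (mat_diag N s * W) $$ (i, j) * s j)"
    by (rule mat_diag_mult_right) (simp add: L)
  have prod: "(mat_diag N s * W * mat_diag N s) $$ (i, j) = s i * W $$ (i, j) * s j"
    unfolding R using ij by (simp add: L)
  have dims: "mat_diag N s * W * mat_diag N s \<in> carrier_mat N N"
    unfolding R by simp
  have "normalized_laplacian W = 1\<^sub>m N - mat_diag N s * W * mat_diag N s"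
    unfolding normalized_laplacian_def Let_def N_def s_def by simp
  then have "normalized_laplacian W $$ (i, j) =
      (if i = j then 1 else 0) - s i * W $$ (i, j) * s j"
    using ij carrier_matD[OF dims] prod by (simp del: index_mult_mat)
  moreover have "s i * s i = 1 / wdegree W i"
    unfolding s_def using nonneg by simp
  moreover have "s i * s j = 1 / sqrt (wdegree W i * wdegree W j)"
    unfolding s_def by (simp add: real_sqrt_mult)
  moreover have "s i * W $$ (i, j) * s j = W $$ (i, j) * (s i * s j)"
    by (simp only: ac_simps)
  ultimately show ?thesis
    by (cases "i = j") simp_all
qed


text \<open>
  Eigenvalues in increasing order, repeated according to algebraic multiplicity. Only real roots of
  the characteristic polynomial are listed; for a real symmetric matrix these are all of them.
  \<open>lambda2\<close> is the entry at position 1 of this list, which is indexed from 0.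
\<close>

definition eigenvalue_list :: "real mat \<Rightarrow> real list" where
  "eigenvalue_list A = sorted_list_of_multiset (proots (char_poly A))"

definition lambda2 :: "real mat \<Rightarrow> real" where
  "lambda2 A = eigenvalue_list A ! 1"

definition simple_eigenvalue :: "real mat \<Rightarrow> real \<Rightarrow> bool" where
  "simple_eigenvalue A e \<longleftrightarrow> eigenvalue A e \<and> Polynomial.order e (char_poly A) = 1"


definition vol :: "real mat \<Rightarrow> nat set \<Rightarrow> real" where
  "vol W A = (\<Sum>i\<in>A. wdegree W i)"

definition cut :: "real mat \<Rightarrow> nat set \<Rightarrow> nat set \<Rightarrow> real" where
  "cut W A B = (\<Sum>i\<in>A. \<Sum>j\<in>B. W $$ (i, j))"

definition Ncut :: "real mat \<Rightarrow> nat set \<Rightarrow> nat set \<Rightarrow> real" where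
  "Ncut W A B = cut W A B * (1 / vol W A + 1 / vol W B)"

definition Mcut :: "real mat \<Rightarrow> real" where
  "Mcut W = Min {Ncut W A (verts W - A) | A. A \<noteq> {} \<and> A \<subset> verts W}"

definition Vpos :: "real vec \<Rightarrow> nat set" where
  "Vpos U = {v \<in> {0..<dim_vec U}. U $ v > 0}"

definition Vneg :: "real vec \<Rightarrow> nat set" where
  "Vneg U = {v \<in> {0..<dim_vec U}. U $ v < 0}"

definition Vzero :: "real vec \<Rightarrow> nat set" where
  "Vzero U = {v \<in> {0..<dim_vec U}. U $ v = 0}"


text \<open>
  Graphs all of whose edges have weight 1. An edge is the set of its endpoints, so a singleton is
  a loop; it contributes 1 to the degree.
\<close>

definition unit_weights :: "nat \<Rightarrow> nat set set \<Rightarrow> real mat" where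
  "unit_weights N E = Matrix.mat N N (\<lambda>(u, v). if {u, v} \<in> E then 1 else 0)"

lemma weight_matrix_unit_weights: "weight_matrix (unit_weights N E)"
  by (auto simp: weight_matrix_def unit_weights_def insert_commute)

text \<open>
  The families below label their vertices from 1. The vertex \<open>x\<^sub>i\<close> is stored at index \<open>i - 1\<close>
  and, in \<open>R\<^bsub>n,k\<^esub>\<close>, the vertex \<open>y\<^sub>i\<close> at index \<open>n + k + i - 1\<close>.
\<close>

definition xv :: "nat \<Rightarrow> nat" where
  "xv i = i - 1"

definition yv :: "nat \<Rightarrow> nat \<Rightarrow> nat \<Rightarrow> nat" where
  "yv n k i = n + k + i - 1"

definition path_graph :: "nat \<Rightarrow> real mat" where
  "path_graph m = unit_weights m {{xv i, xv (i + 1)} | i. 1 \<le> i \<and> i < m}"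

definition P_graph :: "nat \<Rightarrow> nat \<Rightarrow> real mat" where
  "P_graph n k = unit_weights (n + k)
     ({{xv i, xv (i + 1)} | i. 1 \<le> i \<and> i < n + k} \<union>
      {{xv i} | i. n + 1 \<le> i \<and> i \<le> n + k})"

definition R_graph :: "nat \<Rightarrow> nat \<Rightarrow> real mat" where
  "R_graph n k = unit_weights (2 * (n + k))
     ({{xv i, xv (i + 1)} | i. 1 \<le> i \<and> i \<le> n + k - 1} \<union>
      {{yv n k i, yv n k (i + 1)} | i. 1 \<le> i \<and> i \<le> n + k - 1} \<union>
      {{xv i, yv n k i} | i. n + 1 \<le> i \<and> i \<le> n + k})"

definition odd_vector :: "nat \<Rightarrow> nat \<Rightarrow> real vec \<Rightarrow> bool" where
  "odd_vector n k U \<longleftrightarrow> (\<forall>i. 1 \<le> i \<and> i \<le> n + k \<longrightarrow> U $ yv n k i = - (U $ xv i))"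

end

theory Submission
  imports Defs
begin

text \<open>
  Put \<open>t = pi / (4 k - 1)\<close>. Eigenvectors correspond to functions \<open>f\<close> with \<open>W f = \<mu> D f\<close> and \<open>\<mu> = 1 - \<lambda>\<close>. With
  \<open>\<mu> = cos \<theta>\<close>, such an \<open>f\<close> is a multiple of \<open>cos (i \<theta>)\<close> along the path part, hence the path \<open>P\<^bsub>4k\<^esub>\<close> has
  second eigenvalue \<open>1 - cos t\<close>. For \<open>0 < \<theta> \<le> t\<close> the cosine is still positive at the end of the first \<open>2 k\<close>
  vertices, and following the recurrence backwards from the last vertex shows that \<open>f\<close> has one sign on the whole
  chain. For \<open>P\<^bsub>2k,k\<^esub>\<close> this is impossible, which gives (1) and kills the even part of every eigenvector of
  \<open>R\<^bsub>2k,k\<^esub>\<close> with eigenvalue in \<open>(0, 1 - cos t]\<close>. An odd eigenvector with eigenvalue below \<open>1 - cos t\<close> exists by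
  the intermediate value theorem applied to the defect of the last equation, so the eigenvectors for the second
  eigenvalue of \<open>R\<^bsub>2k,k\<^esub>\<close> are odd, determined by their value at \<open>x\<^sub>1\<close>, and of one sign on all \<open>x\<^sub>i\<close>. The spectral
  cut therefore severs the \<open>k\<close> rungs and costs at least \<open>2 / 9\<close>, whereas cutting off \<open>x\<^sub>1, \<dots>, x\<^bsub>2k\<^esub>\<close> severs one
  edge and costs at most \<open>2 / (4 k - 1) < 2 / 9\<close>.
\<close>

section \<open>Simple eigenvalues of symmetric matrices\<close>

text \<open>The matrix is lower triangular, so only the diagonal \<open>g 0, 1, ..., 1\<close>
  counts. This evaluates both determinants that appear beside \<open>det N\<close> in
  \<open>order_char_poly_eq_1\<close>.\<close>

lemma det_first_column_replaced_identity:
  fixes g :: "nat \<Rightarrow> 'a::idom"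
  assumes "0 < n"
  shows "det (mat n n (\<lambda>(i, j). if j = 0 then g i else if i = j then 1 else 0)) = g 0"
proof -
  let ?P = "mat n n (\<lambda>(i, j). if j = 0 then g i else if i = j then 1 else 0)"
  have "det ?P = prod_list (diag_mat ?P)"
    by (rule det_lower_triangular[of n]) auto
  also have "\<dots> = (\<Prod>i = 0..<n. ?P $$ (i, i))"
    by (simp add: prod_list_diag_prod)
  also have "\<dots> = (\<Prod>i = 0..<n. if i = 0 then g 0 else 1)"
    by (rule prod.cong) auto
  also have "\<dots> = g 0"
    using assms by (simp add: prod.delta)
  finally show ?thesis .
qed

lemma char_poly_matrix_index:
  assumes "A \<in> carrier_mat n n" "i < n" "j < n"
  shows "char_poly_matrix A $$ (i, j) = (if i = j then [:0, 1:] else 0) - [:A $$ (i, j):]"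
  using assms by (auto simp: char_poly_matrix_def)

lemma poly_char_poly_matrix_index:
  assumes "A \<in> carrier_mat n n" "i < n" "j < n"
  shows "poly (char_poly_matrix A $$ (i, j)) x = (if i = j then x else 0) - A $$ (i, j)"
  using assms by (simp add: char_poly_matrix_index)

lemma eigenvector_entry:
  assumes "A \<in> carrier_mat n n" "eigenvector A v e" "i < n"
  shows "(\<Sum>l = 0..<n. A $$ (i, l) * v $ l) = e * v $ i"
proof -
  have v: "v \<in> carrier_vec n" "A *\<^sub>v v = e \<cdot>\<^sub>v v"
    using assms by (auto simp: eigenvector_def)
  have "(A *\<^sub>v v) $ i = (\<Sum>l = 0..<n. A $$ (i, l) * v $ l)"
    using assms v(1) by (auto simp: scalar_prod_def)
  then show ?thesis using v assms by simp
qed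

lemma eigenvectorI:
  assumes "A \<in> carrier_mat n n" "v \<in> carrier_vec n" "v \<noteq> 0\<^sub>v n"
    and "\<And>i. i < n \<Longrightarrow> (\<Sum>l = 0..<n. A $$ (i, l) * v $ l) = e * v $ i"
  shows "eigenvector A v e"
proof -
  have "A *\<^sub>v v = e \<cdot>\<^sub>v v"
    by (rule eq_vecI) (use assms in \<open>auto simp: scalar_prod_def\<close>)
  then show ?thesis using assms by (auto simp: eigenvector_def)
qed

text \<open>
  Replacing column 0 of \<open>x - A\<close> by an eigenvector \<open>v\<close> splits off the factor \<open>x - e\<close> from the
  characteristic polynomial. A second factor yields \<open>w\<close> with \<open>w\<^sub>0 = 0\<close> and \<open>(A - e) w\<close> a multiple
  of \<open>v\<close>; symmetry forces this multiple to be zero.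
\<close>

lemma order_char_poly_eq_1:
  fixes A :: "real mat"
  assumes A: "A \<in> carrier_mat n n"
    and sym: "\<And>i j. i < n \<Longrightarrow> j < n \<Longrightarrow> A $$ (i, j) = A $$ (j, i)"
    and ev: "eigenvalue A e"
    and nz: "\<And>v. eigenvector A v e \<Longrightarrow> v $ 0 \<noteq> 0"
  shows "Polynomial.order e (char_poly A) = 1"
proof -
  obtain v where v: "eigenvector A v e"
    using ev by (auto simp: eigenvalue_def)
  have v0: "v $ 0 \<noteq> 0" by (rule nz[OF v])
  have vc: "v \<in> carrier_vec n" "v \<noteq> 0\<^sub>v n"
    using A v by (auto simp: eigenvector_def)
  then have n: "0 < n" by (cases n) (auto simp: eq_vecI)
  define C where "C = char_poly_matrix A"
  define P where "P = mat n n (\<lambda>(i, j). if j = 0 then [:v $ i:] else if i = j then 1 else 0)"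
  define N where "N = mat n n (\<lambda>(i, j). if j = 0 then [:v $ i:] else C $$ (i, j))"
  define d where "d j = (if j = 0 then [:- e, 1:] else (1 :: real poly))" for j :: nat
  have C: "C \<in> carrier_mat n n" using A by (simp add: C_def)
  have P: "P \<in> carrier_mat n n" by (simp add: P_def)
  have N: "N \<in> carrier_mat n n" by (simp add: N_def)
  \<comment> \<open>Column 0 of the product is \<open>(x - A) v = (x - e) v\<close>; every other
    column of \<open>C\<close> is left unchanged by \<open>P\<close>.\<close>
  have "C * P = N * mat_diag n d"
  proof (rule eq_matI)
    fix i j assume "i < dim_row (N * mat_diag n d)" "j < dim_col (N * mat_diag n d)"
    then have ij: "i < n" "j < n" using N by (auto simp: mat_diag_def)
    have R: "(N * mat_diag n d) $$ (i, j) = N $$ (i, j) * d j"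
      using ij by (simp add: mat_diag_mult_right[OF N])
    have L: "(C * P) $$ (i, j) = (\<Sum>l = 0..<n. C $$ (i, l) * P $$ (l, j))"
      using ij C P by (simp add: scalar_prod_def)
    show "(C * P) $$ (i, j) = (N * mat_diag n d) $$ (i, j)"
    proof (cases "j = 0")
      case True
      have "(\<Sum>l = 0..<n. C $$ (i, l) * P $$ (l, j)) =
          (\<Sum>l = 0..<n. (if i = l then [:0, v $ l:] else 0) - [:A $$ (i, l) * v $ l:])"
        by (rule sum.cong) (use True ij A in \<open>auto simp: C_def P_def char_poly_matrix_index\<close>)
      also have "\<dots> = [:0, v $ i:] - (\<Sum>l = 0..<n. [:A $$ (i, l) * v $ l:])"
        using ij by (simp add: sum_subtractf)
      also have "(\<Sum>l = 0..<n. [:A $$ (i, l) * v $ l:]) = [:\<Sum>l = 0..<n. A $$ (i, l) * v $ l:]"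
        by (induction n) auto
      also have "[:0, v $ i:] - \<dots> = [:v $ i:] * [:- e, 1:]"
        using eigenvector_entry[OF A v ij(1)] by simp
      finally show ?thesis using True ij unfolding L R by (simp add: N_def d_def)
    next
      case False
      have "(\<Sum>l = 0..<n. C $$ (i, l) * P $$ (l, j)) = (\<Sum>l = 0..<n. if l = j then C $$ (i, l) else 0)"
        by (rule sum.cong) (use False ij in \<open>auto simp: P_def\<close>)
      then show ?thesis using False ij unfolding L R by (simp add: N_def d_def)
    qed
  qed (use C P N in \<open>auto simp: mat_diag_def\<close>)
  then have "det C * det P = det N * det (mat_diag n d)"
    using C P N by (metis det_mult mat_diag_dim)
  moreover have "det P = [:v $ 0:]"
    using det_first_column_replaced_identity[OF n, of "\<lambda>i. [:v $ i:]"] by (simp add: P_def)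
  moreover have "det (mat_diag n d) = [:- e, 1:]"
  proof -
    have "mat_diag n d = mat n n (\<lambda>(i, j). if j = 0 then (if i = 0 then [:- e, 1:] else 0)
        else if i = j then 1 else 0)"
      by (rule eq_matI) (auto simp: mat_diag_def d_def)
    then show ?thesis
      using det_first_column_replaced_identity[OF n, of "\<lambda>i. if i = 0 then [:- e, 1:] else 0"] by simp
  qed
  ultimately have fac: "Polynomial.smult (v $ 0) (char_poly A) = det N * [:- e, 1:]"
    by (simp add: char_poly_def C_def mult.commute)
  have p0: "char_poly A \<noteq> 0"
    using degree_monic_char_poly[OF A] by (metis coeff_0 zero_neq_one)
  have N0: "poly (det N) e \<noteq> 0"
  proof
    assume "poly (det N) e = 0"
    \<comment> \<open>\<open>M\<close> is \<open>N\<close> evaluated at \<open>x = e\<close>, so a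
      zero determinant yields a kernel vector \<open>w\<close>.\<close>
    define M where "M = mat n n (\<lambda>(i, j). if j = 0 then v $ i else (if i = j then e else 0) - A $$ (i, j))"
    have M: "M \<in> carrier_mat n n" by (simp add: M_def)
    have "poly (det N) e = det M"
      by (rule poly_det_cong[OF M N])
        (use A in \<open>auto simp: M_def N_def C_def poly_char_poly_matrix_index\<close>)
    with \<open>poly (det N) e = 0\<close> obtain w where w: "w \<in> carrier_vec n" "w \<noteq> 0\<^sub>v n" "M *\<^sub>v w = 0\<^sub>v n"
      using det_0_iff_vec_prod_zero[OF M] by auto
    \<comment> \<open>Splitting off the entry at 0 turns \<open>M w = 0\<close> into
      \<open>A z = e z + w 0 * v\<close>.\<close>
    define z where "z = vec n (\<lambda>i. if i = 0 then 0 else w $ i)"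
    have zc: "z \<in> carrier_vec n" by (simp add: z_def)
    have Az: "(\<Sum>j = 0..<n. A $$ (i, j) * z $ j) = e * z $ i + w $ 0 * v $ i" if i: "i < n" for i
    proof -
      have "(M *\<^sub>v w) $ i = (\<Sum>j = 0..<n. M $$ (i, j) * w $ j)"
        using i w(1) M by (auto simp: scalar_prod_def)
      also have "\<dots> = (\<Sum>j = 0..<n. (if j = 0 then v $ i * w $ 0 else 0) +
          ((if i = j then e * z $ j else 0) - A $$ (i, j) * z $ j))"
        by (rule sum.cong) (use i in \<open>auto simp: M_def z_def algebra_simps\<close>)
      also have "\<dots> = v $ i * w $ 0 + (e * z $ i - (\<Sum>j = 0..<n. A $$ (i, j) * z $ j))"
        using i n by (simp add: sum.distrib sum_subtractf)
      finally show ?thesis using w i by (simp add: algebra_simps)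
    qed
    \<comment> \<open>Pair with \<open>v\<close>: symmetry moves \<open>A\<close> onto
      \<open>v\<close>, the terms in \<open>e\<close> cancel, and \<open>w 0\<close> times the
      squared norm of \<open>v\<close> must vanish.\<close>
    have "(\<Sum>i = 0..<n. v $ i * (\<Sum>j = 0..<n. A $$ (i, j) * z $ j)) =
        (\<Sum>j = 0..<n. \<Sum>i = 0..<n. v $ i * (A $$ (i, j) * z $ j))"
      unfolding sum_distrib_left by (rule sum.swap)
    also have "\<dots> = (\<Sum>j = 0..<n. z $ j * (\<Sum>i = 0..<n. A $$ (j, i) * v $ i))"
      unfolding sum_distrib_left by (intro sum.cong) (auto simp: sym mult_ac)
    also have "\<dots> = (\<Sum>j = 0..<n. e * (z $ j * v $ j))"
      by (intro sum.cong) (auto simp: eigenvector_entry[OF A v])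
    finally have "(\<Sum>i = 0..<n. v $ i * (e * z $ i + w $ 0 * v $ i)) = (\<Sum>j = 0..<n. e * (z $ j * v $ j))"
      by (simp add: Az)
    then have "w $ 0 * (\<Sum>i = 0..<n. (v $ i)\<^sup>2) = 0"
      by (simp add: algebra_simps sum.distrib power2_eq_square sum_distrib_left)
    moreover have "(\<Sum>i = 0..<n. (v $ i)\<^sup>2) > 0"
      by (rule sum_pos2[of _ 0]) (use n v0 in auto)
    ultimately have w0: "w $ 0 = 0" by simp
    have "z = w"
      by (rule eq_vecI) (use w w0 in \<open>auto simp: z_def\<close>)
    with w have "z \<noteq> 0\<^sub>v n" by simp
    then have "eigenvector A z e"
      by (rule eigenvectorI[OF A zc]) (simp add: Az w0)
    from nz[OF this] show False using n by (simp add: z_def)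
  qed
  have "Polynomial.order e (char_poly A) = Polynomial.order e (det N * [:- e, 1:])"
    unfolding fac[symmetric] using v0 by (simp add: order_smult)
  also have "\<dots> = Polynomial.order e (det N) + Polynomial.order e [:- e, 1:]"
    by (rule order_mult) (use N0 in \<open>metis mult_eq_0_iff one_neq_zero pCons_eq_0_iff poly_0\<close>)
  also have "Polynomial.order e (det N) = 0"
    using N0 by (rule order_0I)
  also have "Polynomial.order e [:- e, 1:] = 1"
    using order_power_n_n[of e 1] by simp
  finally show ?thesis by simp
qed

text \<open>Evaluating the Hermitian form at an eigenvector gives \<open>z * S = cnj z * S\<close>
  with \<open>S\<close> a positive real. This makes the complex root supplied by the fundamental
  theorem of algebra a real one, hence an entry of \<open>eigenvalue_list\<close>.\<close>

lemma symmetric_complex_root_real: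
  fixes A :: "real mat"
  assumes A: "A \<in> carrier_mat n n"
    and sym: "\<And>i j. i < n \<Longrightarrow> j < n \<Longrightarrow> A $$ (i, j) = A $$ (j, i)"
    and z: "poly (map_poly complex_of_real (char_poly A)) z = 0"
  shows "z \<in> \<real>"
proof -
  define B where "B = map_mat complex_of_real A"
  have B: "B \<in> carrier_mat n n" using A by (simp add: B_def)
  have "char_poly B = map_poly complex_of_real (char_poly A)"
    unfolding B_def by (rule of_real_hom.char_poly_hom[OF A])
  then have "eigenvalue B z"
    unfolding eigenvalue_root_char_poly[OF B] using z by simp
  then obtain v where v: "eigenvector B v z" by (auto simp: eigenvalue_def)
  have vc: "v \<in> carrier_vec n" "v \<noteq> 0\<^sub>v n"
    using B v by (auto simp: eigenvector_def)
  define S where "S = (\<Sum>i = 0..<n. cnj (v $ i) * v $ i)"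
  have "z * S = (\<Sum>i = 0..<n. cnj (v $ i) * (z * v $ i))"
    by (simp add: S_def sum_distrib_left mult_ac)
  also have "\<dots> = (\<Sum>i = 0..<n. cnj (v $ i) * (\<Sum>j = 0..<n. B $$ (i, j) * v $ j))"
    by (rule sum.cong) (auto simp: eigenvector_entry[OF B v])
  also have "\<dots> = (\<Sum>i = 0..<n. \<Sum>j = 0..<n. cnj (v $ i) * (B $$ (i, j) * v $ j))"
    by (simp add: sum_distrib_left)
  also have "\<dots> = (\<Sum>j = 0..<n. \<Sum>i = 0..<n. v $ j * cnj (B $$ (j, i) * v $ i))"
    by (subst sum.swap, intro sum.cong) (use A in \<open>auto simp: B_def sym mult_ac\<close>)
  also have "\<dots> = (\<Sum>j = 0..<n. v $ j * cnj (z * v $ j))"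
    unfolding sum_distrib_left[symmetric] cnj_sum[symmetric]
    by (rule sum.cong) (auto simp: eigenvector_entry[OF B v])
  also have "\<dots> = cnj z * S"
    by (simp add: S_def sum_distrib_left mult_ac)
  finally have eq: "z * S = cnj z * S" .
  have Sr: "S = of_real (\<Sum>i = 0..<n. (cmod (v $ i))\<^sup>2)"
    unfolding S_def of_real_sum
    by (intro sum.cong refl) (metis complex_norm_square mult.commute)
  obtain i where i: "i < n" "v $ i \<noteq> 0"
    using vc by (metis carrier_vecD eq_vecI index_zero_vec)
  have "(\<Sum>i = 0..<n. (cmod (v $ i))\<^sup>2) > 0"
    by (rule sum_pos2[of _ i]) (use i in auto)
  then have "S \<noteq> 0" unfolding Sr by (metis less_irrefl of_real_eq_0_iff)
  with eq have "z = cnj z" by simp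
  then show ?thesis by (metis Reals_cnj_iff)
qed

text \<open>Since 0 is a simple root and no eigenvalue is negative, the list starts with exactly one
  0. For \<open>2 \<le> n\<close> the cofactor \<open>q\<close> of that root has a further root, so
  position 1 exists and holds the smallest nonzero eigenvalue.\<close>

lemma lambda2_least_nonzero_eigenvalue:
  fixes A :: "real mat"
  assumes A: "A \<in> carrier_mat n n" and n: "2 \<le> n"
    and sym: "\<And>i j. i < n \<Longrightarrow> j < n \<Longrightarrow> A $$ (i, j) = A $$ (j, i)"
    and ev: "eigenvalue A 0"
    and nz: "\<And>v. eigenvector A v 0 \<Longrightarrow> v $ 0 \<noteq> 0"
    and nonneg: "\<And>e. eigenvalue A e \<Longrightarrow> 0 \<le> e"
  shows "eigenvalue A (lambda2 A)" "lambda2 A > 0"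
    "\<And>e. eigenvalue A e \<Longrightarrow> e \<noteq> 0 \<Longrightarrow> lambda2 A \<le> e"
proof -
  define p where "p = char_poly A"
  have dp: "degree p = n" and p0: "p \<noteq> 0"
    using degree_monic_char_poly[OF A] n by (auto simp: p_def)
  have root: "eigenvalue A e \<longleftrightarrow> poly p e = 0" for e
    unfolding p_def by (rule eigenvalue_root_char_poly[OF A])
  have ord: "Polynomial.order 0 p = 1"
    unfolding p_def by (rule order_char_poly_eq_1[OF A sym ev nz])
  then obtain q where q: "p = [:0, 1:] * q"
    using order_1[of 0 p] by (auto simp: dvd_def)
  have q0: "q \<noteq> 0" using q p0 by auto
  have "degree q \<noteq> 0"
    using dp n unfolding q by (subst (asm) degree_mult_eq) (use q0 in auto)
  then have "\<not> constant (poly (map_poly complex_of_real q))"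
    by (simp add: constant_degree)
  then obtain z where z: "poly (map_poly complex_of_real q) z = 0"
    using fundamental_theorem_of_algebra by blast
  have "map_poly complex_of_real p = pCons 0 (map_poly complex_of_real q)"
    by (intro poly_eqI) (simp add: q coeff_map_poly coeff_pCons split: nat.splits)
  then have "z \<in> \<real>"
    using symmetric_complex_root_real[OF A sym, of z] z by (simp add: p_def)
  then obtain r where r: "z = of_real r" by (auto simp: Reals_def)
  have qr: "poly q r = 0" using z unfolding r by simp
  have pr: "poly p r = 0" using qr by (simp add: q)
  have "r \<noteq> 0"
  proof
    assume "r = 0"
    with qr have "[:- 0, 1:] ^ 1 dvd q" by (simp add: poly_eq_0_iff_dvd)
    then have "[:- 0, 1:] ^ 2 dvd p"
      unfolding q power2_eq_square by (metis dvd_refl minus_zero mult_dvd_mono power_one_right)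
    then show False using order_max[of 0 2 p] p0 ord by (simp del: power_Suc)
  qed
  define E where "E = {e. poly p e = 0 \<and> e \<noteq> 0}"
  \<comment> \<open>Removing one copy of 0 leaves only the nonzero roots, because 0 has order
    1.\<close>
  define xs where "xs = sorted_list_of_multiset (proots p - {#0#})"
  have cnt: "count (proots p) x = Polynomial.order x p" for x using p0 by simp
  have in0: "0 \<in># proots p" by (rule count_inI) (use ord cnt[of 0] in simp)
  have mset: "set xs = E"
  proof (rule Set.set_eqI)
    fix x
    have "x \<in> set xs \<longleftrightarrow> count (proots p - {#0#}) x > 0"
      by (simp only: xs_def set_sorted_list_of_multiset count_greater_zero_iff)
    also have "\<dots> \<longleftrightarrow> x \<in> E"
    proof (cases "x = 0")
      case True
      then show ?thesis using ord cnt[of 0] by (simp add: E_def)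
    next
      case False
      then have "count (proots p - {#0#}) x = Polynomial.order x p" using cnt[of x] by simp
      then show ?thesis using False p0 by (simp add: E_def order_gt_0_iff)
    qed
    finally show "x \<in> set xs \<longleftrightarrow> x \<in> E" .
  qed
  have "sorted xs" by (simp add: xs_def)
  moreover have "\<forall>x\<in>set xs. 0 \<le> x"
    unfolding mset E_def using nonneg root by blast
  ultimately have "sorted (0 # xs)" by simp
  moreover have "mset (0 # xs) = proots p"
    using in0 by (simp add: xs_def)
  ultimately have list: "eigenvalue_list A = 0 # xs"
    unfolding eigenvalue_list_def p_def[symmetric]
    by (metis sorted_list_of_multiset_mset sorted_sort_id)
  have "r \<in> set xs" using mset pr \<open>r \<noteq> 0\<close> by (auto simp: E_def)
  then obtain y ys where xs: "xs = y # ys" by (cases xs) auto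
  have l2: "lambda2 A = y" by (simp add: lambda2_def list xs)
  have "y \<in> E" using mset xs by auto
  then show "eigenvalue A (lambda2 A)" "lambda2 A > 0"
    using nonneg[of y] by (auto simp: l2 E_def root)
  fix e assume "eigenvalue A e" "e \<noteq> 0"
  then have "e \<in> set xs" by (simp add: mset E_def root)
  moreover have "sorted xs" by (simp add: xs_def)
  ultimately show "lambda2 A \<le> e" by (auto simp: l2 xs)
qed

section \<open>The three-term recurrence\<close>

text \<open>
  All three graphs reduce to one recurrence on \<open>{0..<M}\<close> with loops at the vertices \<open>i \<ge> n\<close>: the path is
  \<open>n = M\<close>, \<open>P\<^bsub>n,k\<^esub>\<close> is \<open>s = 1\<close>, and \<open>R\<^bsub>n,k\<^esub>\<close> splits into its even part, \<open>s = 1\<close>, and its odd part,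
  \<open>s = -1\<close>. The sign \<open>s\<close> affects the loop terms but not the degrees.
\<close>

definition nbr_sum :: "nat \<Rightarrow> (nat \<Rightarrow> real) \<Rightarrow> nat \<Rightarrow> real" where
  "nbr_sum M f i = (if 0 < i then f (i - 1) else 0) + (if i + 1 < M then f (i + 1) else 0)"

definition chain_degree :: "nat \<Rightarrow> nat \<Rightarrow> nat \<Rightarrow> real" where
  "chain_degree n M i = nbr_sum M (\<lambda>_. 1) i + (if n \<le> i then 1 else 0)"

definition chain :: "nat \<Rightarrow> nat \<Rightarrow> real \<Rightarrow> real \<Rightarrow> (nat \<Rightarrow> real) \<Rightarrow> bool" where
  "chain n M s \<mu> f \<longleftrightarrow> (\<forall>i<M. nbr_sum M f i + (if n \<le> i then s * f i else 0) = \<mu> * chain_degree n M i * f i)"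

lemma chain_degree_bounds:
  assumes "i < M" "2 \<le> M"
  shows "1 \<le> chain_degree n M i" "chain_degree n M i \<le> 3"
  using assms by (auto simp: chain_degree_def nbr_sum_def)

text \<open>Here and in the next four lemmas, one equation is solved for one value. The coefficient
  is the degree times \<open>\<mu>\<close>, corrected by the loop: degree 1 at the first vertex, 2
  inside the path, 3 inside the ladder, and at the last vertex 2 with a loop or 1 without.\<close>

lemma chain_first:
  assumes "chain n M s \<mu> f" "1 \<le> n" "2 \<le> M"
  shows "f (Suc 0) = \<mu> * f 0"
  using assms by (auto simp: chain_def chain_degree_def nbr_sum_def dest: spec[of _ 0])

lemma chain_path_step:
  assumes "chain n M s \<mu> f" "Suc i < n" "Suc (Suc i) < M"
  shows "f (Suc (Suc i)) = 2 * \<mu> * f (Suc i) - f i"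
  using assms by (auto simp: chain_def chain_degree_def nbr_sum_def algebra_simps dest: spec[of _ "Suc i"])

lemma chain_ladder_step:
  assumes "chain n M s \<mu> f" "n \<le> Suc i" "Suc (Suc i) < M"
  shows "f (Suc (Suc i)) = (3 * \<mu> - s) * f (Suc i) - f i"
  using assms by (auto simp: chain_def chain_degree_def nbr_sum_def algebra_simps dest: spec[of _ "Suc i"])

lemma chain_last:
  assumes "chain n M s \<mu> f" "n \<le> Suc i" "Suc (Suc i) = M"
  shows "f i = (2 * \<mu> - s) * f (Suc i)"
  using assms by (auto simp: chain_def chain_degree_def nbr_sum_def algebra_simps dest: spec[of _ "Suc i"])

lemma chain_last_path:
  assumes "chain n M s \<mu> f" "Suc i < n" "Suc (Suc i) = M"
  shows "f i = \<mu> * f (Suc i)"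
  using assms by (auto simp: chain_def chain_degree_def nbr_sum_def algebra_simps dest: spec[of _ "Suc i"])

lemma chain_scale:
  assumes "chain n M s \<mu> f"
  shows "chain n M s \<mu> (\<lambda>i. c * f i)"
proof -
  have "nbr_sum M (\<lambda>i. c * f i) i + (if n \<le> i then s * (c * f i) else 0) =
      c * (nbr_sum M f i + (if n \<le> i then s * f i else 0))" for i
    by (simp add: nbr_sum_def algebra_simps)
  then show ?thesis using assms by (simp add: chain_def)
qed

text \<open>The recurrence determines all values from \<open>f 0\<close>, so each
  \<open>\<mu>\<close> admits at most a one-dimensional space of solutions.\<close>

lemma chain_eq_zero:
  assumes f: "chain n M s \<mu> f" and "1 \<le> n" "2 \<le> M" "f 0 = 0"
  shows "i < M \<Longrightarrow> f i = 0"
proof (induction i rule: less_induct)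
  case (less i)
  consider "i = 0" | "i = Suc 0" | j where "i = Suc (Suc j)"
    by (metis not0_implies_Suc)
  then show ?case
  proof cases
    case (3 j)
    then have "f j = 0" "f (Suc j) = 0" using less by auto
    then show ?thesis
      using chain_path_step[OF f, of j] chain_ladder_step[OF f, of j] less.prems 3
      by (cases "Suc j < n") auto
  qed (use assms chain_first[OF f] in auto)
qed

lemma cos_Suc_Suc_mult:
  fixes \<theta> :: real
  shows "cos (real (Suc (Suc j)) * \<theta>) = 2 * cos \<theta> * cos (real (Suc j) * \<theta>) - cos (real j * \<theta>)"
proof -
  have "real (Suc (Suc j)) * \<theta> = real (Suc j) * \<theta> + \<theta>" "real j * \<theta> = real (Suc j) * \<theta> - \<theta>"
    by (simp_all add: algebra_simps)
  then show ?thesis by (simp add: cos_add cos_diff)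
qed

text \<open>Both sides satisfy the same recurrence with the same first two values. The index
  \<open>n\<close> is included, as its value comes from the equation at \<open>n - 1\<close>, which
  has no loop.\<close>

lemma chain_cos:
  assumes f: "chain n M s (cos \<theta>) f" and "1 \<le> n" "2 \<le> M"
  shows "i \<le> n \<Longrightarrow> i < M \<Longrightarrow> f i = f 0 * cos (real i * \<theta>)"
proof (induction i rule: less_induct)
  case (less i)
  consider "i = 0" | "i = Suc 0" | j where "i = Suc (Suc j)"
    by (metis not0_implies_Suc)
  then show ?case
  proof cases
    case (3 j)
    then have "f j = f 0 * cos (real j * \<theta>)" "f (Suc j) = f 0 * cos (real (Suc j) * \<theta>)"
      using less.IH[of j] less.IH[of "Suc j"] less.prems by (auto simp del: of_nat_Suc)
    moreover have "f (Suc (Suc j)) = 2 * cos \<theta> * f (Suc j) - f j"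
      by (rule chain_path_step[OF f]) (use less.prems 3 in auto)
    ultimately show ?thesis
      unfolding 3 cos_Suc_Suc_mult by (simp add: algebra_simps)
  qed (use assms chain_first[OF f] in \<open>simp_all add: mult.commute\<close>)
qed

text \<open>The recurrence for \<open>cos (i \<theta>)\<close> settles all equations but the last,
  which amounts to \<open>sin ((m - 1) \<theta>) * sin \<theta> = 0\<close>.\<close>

lemma chain_path_cos:
  assumes "2 \<le> m" and \<theta>: "real (m - 1) * \<theta> = pi"
  shows "chain m m s (cos \<theta>) (\<lambda>i. cos (real i * \<theta>))"
  unfolding chain_def
proof (intro allI impI)
  fix i assume i: "i < m"
  let ?f = "\<lambda>i. cos (real i * \<theta>)"
  consider "i = 0" | j where "i = Suc j" "Suc (Suc j) < m" | j where "m = Suc (Suc j)" "i = Suc j"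
    using i by (metis Suc_lessI not0_implies_Suc)
  then have "nbr_sum m ?f i = cos \<theta> * chain_degree m m i * ?f i"
  proof cases
    case (2 j)
    then show ?thesis
      using cos_Suc_Suc_mult[of j \<theta>] by (simp add: nbr_sum_def chain_degree_def del: of_nat_Suc)
  next
    case (3 j)
    then have j: "real (Suc j) * \<theta> = pi" using \<theta> by simp
    then have "real j * \<theta> = pi - \<theta>" by (simp add: algebra_simps)
    then show ?thesis using 3 j
      by (simp add: nbr_sum_def chain_degree_def del: of_nat_Suc)
  qed (use assms in \<open>auto simp: nbr_sum_def chain_degree_def\<close>)
  then show "nbr_sum m ?f i + (if m \<le> i then s * ?f i else 0) = cos \<theta> * chain_degree m m i * ?f i"
    using i by simp
qed

text \<open>For these angles both factors in \<open>sin ((m - 1) \<theta>) * sin \<theta>\<close>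
  are positive, so the last equation fails for every nonzero multiple of
  \<open>cos (i \<theta>)\<close>.\<close>

lemma chain_path_small_angle:
  assumes f: "chain m m s (cos \<theta>) f" and m: "2 \<le> m" and \<theta>: "0 < \<theta>" "real (m - 1) * \<theta> < pi"
  shows "f 0 = 0"
proof (rule ccontr)
  assume f0: "f 0 \<noteq> 0"
  obtain j where j: "m = Suc (Suc j)" using m by (metis add_2_eq_Suc le_Suc_ex)
  have "f j = cos \<theta> * f (Suc j)"
    by (rule chain_last_path[OF f]) (auto simp: j)
  moreover have "f j = f 0 * cos (real j * \<theta>)" "f (Suc j) = f 0 * cos (real (Suc j) * \<theta>)"
    using chain_cos[OF f _ m, of j] chain_cos[OF f _ m, of "Suc j"] j by (auto simp del: of_nat_Suc)
  ultimately have "cos (real j * \<theta>) = cos \<theta> * cos (real (Suc j) * \<theta>)"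
    using f0 by simp
  moreover have "cos (real j * \<theta>) = cos (real (Suc j) * \<theta> - \<theta>)"
    by (simp add: algebra_simps)
  ultimately have "sin (real (Suc j) * \<theta>) * sin \<theta> = 0"
    by (simp add: cos_diff del: of_nat_Suc)
  moreover have "sin (real (Suc j) * \<theta>) > 0"
    by (rule sin_gt_zero) (use \<theta> j in auto)
  moreover have "\<theta> < pi"
  proof -
    have "1 * \<theta> \<le> real (m - 1) * \<theta>"
      by (rule mult_right_mono) (use \<theta> j in auto)
    also have "\<dots> < pi" by fact
    finally show ?thesis by simp
  qed
  then have "sin \<theta> > 0" using \<theta> by (intro sin_gt_zero)
  ultimately show False by simp
qed

text \<open>
  Reading the chain backwards from its last vertex, with \<open>h j = f (M - 1 - j)\<close>: for \<open>s = -1\<close> the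
  values \<open>h j\<close> increase, for \<open>s = 1\<close> they drop by at most \<open>(1 - \<mu>) (3 j + 2) h 0\<close> per step.
\<close>

lemma ladder_backward_minus:
  fixes h :: "nat \<Rightarrow> real"
  assumes h1: "h (Suc 0) = (2 * \<mu> + 1) * h 0"
    and hs: "\<And>j. Suc j < k \<Longrightarrow> h (Suc (Suc j)) = (3 * \<mu> + 1) * h (Suc j) - h j"
    and \<mu>: "1 / 3 \<le> \<mu>" and h0: "0 \<le> h 0" and k: "0 < k"
  shows "j \<le> k \<Longrightarrow> h 0 \<le> h j"
proof -
  have "j < k \<Longrightarrow> h 0 \<le> h j \<and> h j \<le> h (Suc j)" for j
  proof (induction j)
    case 0
    have "1 * h 0 \<le> (2 * \<mu> + 1) * h 0" by (rule mult_right_mono) (use \<mu> h0 in auto)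
    then show ?case using h1 by simp
  next
    case (Suc j)
    then have IH: "h 0 \<le> h j" "h j \<le> h (Suc j)" by auto
    \<comment> \<open>Since \<open>2 \<le> 3 * \<mu> + 1\<close>, the next increment is at least the
      previous one.\<close>
    have "2 * h (Suc j) \<le> (3 * \<mu> + 1) * h (Suc j)"
      by (rule mult_right_mono) (use \<mu> h0 IH in auto)
    then show ?case using hs[of j] Suc.prems IH by simp
  qed
  from this[of "j - 1"] show "j \<le> k \<Longrightarrow> h 0 \<le> h j"
    using h0 by (cases j) auto
qed

lemma ladder_backward_plus:
  fixes h :: "nat \<Rightarrow> real"
  assumes h1: "h (Suc 0) = (2 * \<mu> - 1) * h 0"
    and hs: "\<And>j. Suc j < k \<Longrightarrow> h (Suc (Suc j)) = (3 * \<mu> - 1) * h (Suc j) - h j"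
    and \<mu>: "\<mu> \<le> 1" "(1 - \<mu>) * (3 * real k ^ 2 + real k) < 2" and h0: "0 \<le> h 0" and k: "0 < k"
  shows "j \<le> k \<Longrightarrow> (1 - (1 - \<mu>) * (3 * real j ^ 2 + real j) / 2) * h 0 \<le> h j"
proof -
  \<comment> \<open>\<open>b j\<close> is \<open>h 0\<close> minus the drops allowed so far: the sum
    of \<open>3 i + 2\<close> over \<open>i < j\<close> is \<open>(3 j^2 + j) / 2\<close>. The bound
    on \<open>\<mu>\<close> keeps it nonnegative up to \<open>k\<close>.\<close>
  define b where "b j = (1 - (1 - \<mu>) * (3 * real j ^ 2 + real j) / 2) * h 0" for j
  have b0: "0 \<le> b j" if "j \<le> k" for j
  proof -
    have "(1 - \<mu>) * (3 * real j ^ 2 + real j) \<le> (1 - \<mu>) * (3 * real k ^ 2 + real k)"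
      by (intro mult_left_mono add_mono power_mono) (use that \<mu> in auto)
    then show ?thesis using \<mu> h0 by (simp add: b_def)
  qed
  have bS: "b (Suc j) = b j - (1 - \<mu>) * (3 * real j + 2) * h 0" for j
    by (simp add: b_def power2_eq_square field_simps)
  have step: "h (Suc j) \<le> h j \<and> h j - h (Suc j) \<le> (1 - \<mu>) * (3 * real j + 2) * h 0 \<and> b j \<le> h j \<and> h j \<le> h 0"
    if "j < k" for j
    using that
  proof (induction j)
    case 0
    have "0 \<le> (1 - \<mu>) * h 0" using \<mu> h0 by simp
    then show ?case using h1 by (simp add: b_def algebra_simps)
  next
    case (Suc j)
    then have IH: "h (Suc j) \<le> h j" "h j - h (Suc j) \<le> (1 - \<mu>) * (3 * real j + 2) * h 0"
        "b j \<le> h j" "h j \<le> h 0" by auto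
    have bh: "b (Suc j) \<le> h (Suc j)" using IH bS[of j] by linarith
    have "0 \<le> h (Suc j)" using b0[of "Suc j"] bh Suc.prems by simp
    then have pos: "0 \<le> (1 - \<mu>) * h (Suc j)" using \<mu> by simp
    have "(1 - \<mu>) * h (Suc j) \<le> (1 - \<mu>) * h 0"
      by (rule mult_left_mono) (use IH \<mu> in auto)
    \<comment> \<open>Each drop exceeds the one before by \<open>3 (1 - \<mu>) h (Suc j)\<close>, at
      most \<open>3 (1 - \<mu>) h 0\<close>; hence the passage from \<open>3 j + 2\<close> to
      \<open>3 (j + 1) + 2\<close>.\<close>
    moreover have "h (Suc j) - h (Suc (Suc j)) = (h j - h (Suc j)) + 3 * ((1 - \<mu>) * h (Suc j))"
      using hs[of j] Suc.prems by (simp add: algebra_simps)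
    ultimately show ?case using IH bh pos by (simp add: algebra_simps)
  qed
  have "b j \<le> h j" if "j \<le> k"
  proof (cases j)
    case 0
    then show ?thesis by (simp add: b_def)
  next
    case (Suc i)
    with that step[of i] have "b i \<le> h i" "h i - h (Suc i) \<le> (1 - \<mu>) * (3 * real i + 2) * h 0" by auto
    then show ?thesis using bS[of i] unfolding Suc by linarith
  qed
  then show "j \<le> k \<Longrightarrow> (1 - (1 - \<mu>) * (3 * real j ^ 2 + real j) / 2) * h 0 \<le> h j"
    by (simp add: b_def)
qed

section \<open>Numerical bounds for angles up to \<open>pi / (4 k - 1)\<close>\<close>

lemma one_minus_cos_le:
  fixes x :: real
  shows "1 - cos x \<le> x\<^sup>2 / 2"
proof -
  have "cos x = 1 - 2 * (sin (x / 2))\<^sup>2"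
    using cos_double_sin[of "x / 2"] by simp
  moreover have "(sin (x / 2))\<^sup>2 \<le> (x / 2)\<^sup>2"
    using abs_sin_x_le_abs_x[of "x / 2"] unfolding abs_le_square_iff .
  ultimately show ?thesis by (simp add: power_divide)
qed

text \<open>This is the smallness that \<open>ladder_backward_plus\<close> needs. From
  \<open>1 - cos \<theta> \<le> \<theta>^2 / 2\<close> and \<open>pi < 4\<close> it reduces to
  \<open>0 < 8 (K - 3) K + 2\<close>, and here \<open>3 \<le> k\<close> enters.\<close>

lemma small_angle_bound:
  assumes k: "3 \<le> k" and \<theta>: "0 \<le> \<theta>" "\<theta> \<le> pi / real (4 * k - 1)"
  shows "(1 - cos \<theta>) * (3 * real k ^ 2 + real k) < 2"
proof -
  define K where "K = real k"
  have K: "3 \<le> K" "real (4 * k - 1) = 4 * K - 1" using k by (auto simp: K_def of_nat_diff)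
  have "\<theta> \<le> 4 / (4 * K - 1)"
  proof -
    have "pi / (4 * K - 1) \<le> 4 / (4 * K - 1)"
      by (rule divide_right_mono) (use K pi_less_4 in auto)
    then show ?thesis using \<theta>(2) unfolding K(2) by linarith
  qed
  then have "\<theta>\<^sup>2 \<le> (4 / (4 * K - 1))\<^sup>2"
    using \<theta> by (intro power_mono) auto
  then have "1 - cos \<theta> \<le> 8 / (4 * K - 1)\<^sup>2"
    using one_minus_cos_le[of \<theta>] by (simp add: power_divide)
  then have "(1 - cos \<theta>) * (3 * K ^ 2 + K) \<le> 8 / (4 * K - 1)\<^sup>2 * (3 * K ^ 2 + K)"
    using K by (intro mult_right_mono) auto
  also have "\<dots> < 2"
  proof -
    have "0 \<le> (K - 3) * K" using K by simp
    then have "8 * (3 * K ^ 2 + K) < 2 * (4 * K - 1)\<^sup>2"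
      by (simp add: power2_eq_square algebra_simps)
    then show ?thesis using K by (simp add: divide_simps)
  qed
  finally show ?thesis by (simp add: K_def)
qed

text \<open>A cosine below \<open>1 / 3\<close> would make the left side of
  \<open>small_angle_bound\<close> at least \<open>2 k^2 \<ge> 18\<close>. The threshold is the one
  in \<open>ladder_backward_minus\<close>.\<close>

lemma small_angle_cos_ge:
  assumes k: "3 \<le> k" and \<theta>: "0 \<le> \<theta>" "\<theta> \<le> pi / real (4 * k - 1)"
  shows "1 / 3 \<le> cos \<theta>"
proof (rule ccontr)
  assume "\<not> ?thesis"
  then have "2 / 3 * (3 * real k ^ 2 + real k) \<le> (1 - cos \<theta>) * (3 * real k ^ 2 + real k)"
    by (intro mult_right_mono) auto
  moreover have "2 * real k ^ 2 \<ge> 2 * 3 ^ 2"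
    by (intro mult_left_mono power_mono) (use k in auto)
  ultimately show False using small_angle_bound[OF assms] by simp
qed

text \<open>On the path part the angles \<open>i \<theta>\<close> stay below \<open>pi / 2\<close>.
  A last value \<open>\<le> 0\<close> would, by the backward bounds applied to \<open>- f\<close>,
  force a value \<open>\<le> 0\<close> at the last path vertex; so the last value is positive, and
  the same bounds applied to \<open>f\<close> cover the ladder.\<close>

lemma chain_positive:
  assumes f: "chain (2 * k) (3 * k) s (cos \<theta>) f" and s: "s = 1 \<or> s = - 1" and k: "3 \<le> k"
    and \<theta>: "0 \<le> \<theta>" "\<theta> \<le> pi / real (4 * k - 1)" and f0: "0 < f 0" and i: "i < 3 * k"
  shows "0 < f i"
proof -
  let ?\<mu> = "cos \<theta>"
  have bound: "(1 - ?\<mu>) * (3 * real k ^ 2 + real k) < 2"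
    by (rule small_angle_bound) fact+
  have path: "0 < f i" if "i < 2 * k" for i
  proof -
    have "real i * \<theta> \<le> real (2 * k - 1) * (pi / real (4 * k - 1))"
      by (rule mult_mono) (use that \<theta> in auto)
    also have "\<dots> < pi / 2"
      using k by (simp add: field_simps of_nat_diff)
    finally have "0 < cos (real i * \<theta>)"
      using \<theta> by (intro cos_gt_zero_pi) (auto intro: less_le_trans[of _ 0])
    then show ?thesis
      using chain_cos[OF f, of i] that f0 k by simp
  qed
  have \<mu>: "1 / 3 \<le> ?\<mu>"
  by (rule small_angle_cos_ge) fact+
  \<comment> \<open>The factor in the two backward bounds. It is positive up to
    \<open>j = k\<close>, which reaches back to the path vertex \<open>2 k - 1\<close>.\<close>
  define c where "c j = (if s = 1 then 1 - (1 - ?\<mu>) * (3 * real j ^ 2 + real j) / 2 else 1)" for j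
  have c: "0 < c j" if "j \<le> k" for j
  proof -
    have "(1 - ?\<mu>) * (3 * real j ^ 2 + real j) \<le> (1 - ?\<mu>) * (3 * real k ^ 2 + real k)"
      by (intro mult_left_mono add_mono power_mono) (use that in auto)
    then show ?thesis using bound by (simp add: c_def)
  qed
  have backward: "c j * g (3 * k - 1) \<le> g (3 * k - 1 - j)"
    if g: "chain (2 * k) (3 * k) s ?\<mu> g" and g0: "0 \<le> g (3 * k - 1)" and j: "j \<le> k" for g j
  proof -
    define h where "h j = g (3 * k - 1 - j)" for j
    have h1: "h (Suc 0) = (2 * ?\<mu> - s) * h 0"
      using chain_last[OF g, of "3 * k - 2"] k by (simp add: h_def Suc_diff_Suc numeral_2_eq_2)
    have hs: "h (Suc (Suc j)) = (3 * ?\<mu> - s) * h (Suc j) - h j" if "Suc j < k" for j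
    proof -
      define l where "l = 3 * k - 3 - j"
      have l: "3 * k - 1 - Suc (Suc j) = l" "3 * k - 1 - Suc j = Suc l" "3 * k - 1 - j = Suc (Suc l)"
        using that by (auto simp: l_def)
      have "g (Suc (Suc l)) = (3 * ?\<mu> - s) * g (Suc l) - g l"
        by (rule chain_ladder_step[OF g]) (use that in \<open>auto simp: l_def\<close>)
      then show ?thesis unfolding h_def l by simp
    qed
    have h0: "0 \<le> h 0" using g0 by (simp add: h_def)
    have "c j * h 0 \<le> h j"
      using ladder_backward_plus[of h ?\<mu> k j] ladder_backward_minus[of h ?\<mu> k j]
        h1 hs h0 \<mu> s bound k j by (auto simp: c_def)
    then show ?thesis by (simp add: h_def)
  qed
  have last: "0 < f (3 * k - 1)"
  proof (rule ccontr)
    assume "\<not> ?thesis"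
    then have le: "0 \<le> (- 1) * f (3 * k - 1)" by simp
    have "c k * ((- 1) * f (3 * k - 1)) \<le> (- 1) * f (3 * k - 1 - k)"
      by (rule backward[OF chain_scale[OF f] le]) simp
    moreover have "0 \<le> c k * ((- 1) * f (3 * k - 1))"
      by (rule mult_nonneg_nonneg[OF less_imp_le[OF c] le]) simp
    moreover have "0 < f (3 * k - 1 - k)"
      by (rule path) (use k in auto)
    ultimately show False by simp
  qed
  show ?thesis
  proof (cases "i < 2 * k")
    case False
    define j where "j = 3 * k - 1 - i"
    have j: "j \<le> k" "3 * k - 1 - j = i" using False i by (auto simp: j_def)
    have "0 < c j * f (3 * k - 1)" using c[OF j(1)] last by simp
    also have "\<dots> \<le> f i" using backward[OF f, of j] last j by simp
    finally show ?thesis .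
  qed (rule path)
qed

text \<open>A positive solution for \<open>s = 1\<close> would decrease along the chain, against the last equation.\<close>

lemma even_chain_zero:
  assumes f: "chain (2 * k) (3 * k) 1 (cos \<theta>) f" and k: "3 \<le> k"
    and \<theta>: "0 < \<theta>" "\<theta> \<le> pi / real (4 * k - 1)" and i: "i < 3 * k"
  shows "f i = 0"
proof -
  let ?\<mu> = "cos \<theta>"
  have "\<theta> < pi"
  proof -
    have "pi / real (4 * k - 1) < pi / 1"
      by (rule divide_strict_left_mono) (use k in auto)
    then show ?thesis using \<theta> by simp
  qed
  then have \<mu>: "?\<mu> < 1" using cos_monotone_0_pi[of 0 \<theta>] \<theta> by simp
  have not_pos: "\<not> 0 < g 0" if g: "chain (2 * k) (3 * k) 1 ?\<mu> g" for g
  proof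
    assume "0 < g 0"
    then have pos: "0 < g i" if "i < 3 * k" for i
      using chain_positive[OF g _ k _ \<theta>(2) _ that] \<theta>(1) by simp
    have dec: "Suc i < 3 * k \<Longrightarrow> g (Suc i) < g i" for i
    proof (induction i)
      case 0
      have "?\<mu> * g 0 < 1 * g 0" by (rule mult_strict_right_mono) (use \<mu> pos[of 0] k in auto)
      then show ?case using chain_first[OF g] k by simp
    next
      case (Suc i)
      have "?\<mu> * g (Suc i) < 1 * g (Suc i)"
        by (rule mult_strict_right_mono) (use \<mu> pos[of "Suc i"] Suc in auto)
      then show ?case
        using Suc chain_path_step[OF g, of i] chain_ladder_step[OF g, of i]
        by (cases "Suc i < 2 * k") (auto simp: algebra_simps)
    qed
    define l where "l = 3 * k - 2"
    have l: "Suc (Suc l) = 3 * k" using k by (simp add: l_def)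
    have "g l = (2 * ?\<mu> - 1) * g (Suc l)"
      by (rule chain_last[OF g _ l]) (use k in \<open>auto simp: l_def\<close>)
    moreover have "?\<mu> * g (Suc l) < 1 * g (Suc l)"
      by (rule mult_strict_right_mono) (use \<mu> pos[of "Suc l"] l in auto)
    ultimately show False using dec[of l] l by (simp add: algebra_simps)
  qed
  from not_pos[OF f] not_pos[OF chain_scale[OF f, of "- 1"]] have "f 0 = 0" by simp
  then show ?thesis using chain_eq_zero[OF f _ _ _ i] k by simp
qed

text \<open>The odd recurrence (\<open>s = -1\<close>) run forwards from value 1, for any
  \<open>\<mu>\<close> and without the last equation. Each value is a polynomial in
  \<open>\<mu>\<close>, hence continuous.\<close>

fun shoot :: "nat \<Rightarrow> real \<Rightarrow> nat \<Rightarrow> real" where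
  "shoot n \<mu> 0 = 1"
| "shoot n \<mu> (Suc 0) = \<mu>"
| "shoot n \<mu> (Suc (Suc i)) =
    (if Suc i < n then 2 * \<mu> else 3 * \<mu> + 1) * shoot n \<mu> (Suc i) - shoot n \<mu> i"

lemma continuous_on_shoot: "continuous_on UNIV (\<lambda>\<mu>. shoot n \<mu> i)"
proof (induction i rule: induct_nat_012)
  case (ge2 i)
  then show ?case
    by (cases "Suc i < n") (auto intro!: continuous_intros)
qed (auto intro!: continuous_intros)

lemma chain_shoot:
  assumes "1 \<le> n" "n \<le> Suc l" and "(2 * \<mu> + 1) * shoot n \<mu> (Suc l) = shoot n \<mu> l"
  shows "chain n (Suc (Suc l)) (- 1) \<mu> (shoot n \<mu>)"
  unfolding chain_def
proof (intro allI impI)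
  fix i assume i: "i < Suc (Suc l)"
  consider "i = 0" | "i = Suc l" | j where "i = Suc j" "j < l"
    using i by (cases i) (auto simp: less_Suc_eq)
  then show "nbr_sum (Suc (Suc l)) (shoot n \<mu>) i + (if n \<le> i then - 1 * shoot n \<mu> i else 0) =
      \<mu> * chain_degree n (Suc (Suc l)) i * shoot n \<mu> i"
    by cases (use assms in \<open>auto simp: nbr_sum_def chain_degree_def algebra_simps\<close>)
qed

lemma shoot_at_1: "1 \<le> shoot n 1 i \<and> shoot n 1 i \<le> shoot n 1 (Suc i)"
  by (induction i) auto

lemma shoot_cos: "i \<le> n \<Longrightarrow> shoot n (cos \<theta>) i = cos (real i * \<theta>)"
proof (induction i rule: induct_nat_012)
  case (ge2 j)
  then show ?case
    unfolding cos_Suc_Suc_mult by simp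
qed auto

text \<open>The defect \<open>G\<close> of the last equation changes sign. At
  \<open>cos \<theta>\<close> with \<open>\<theta> = pi / (4 k - 1)\<close> the values turn negative
  between the indices \<open>2 k - 1\<close> and \<open>2 k\<close> and do not rise afterwards, so
  \<open>G < 0\<close>; at 1 they are positive and never fall, so \<open>G > 0\<close>.\<close>

lemma exists_odd_chain:
  assumes k: "3 \<le> k"
  obtains \<mu> f where "cos (pi / real (4 * k - 1)) < \<mu>" "\<mu> < 1"
    "chain (2 * k) (3 * k) (- 1) \<mu> f" "f 0 = 1"
proof -
  define \<theta> where "\<theta> = pi / real (4 * k - 1)"
  define l where "l = 3 * k - 2"
  have l: "Suc (Suc l) = 3 * k" using k by (simp add: l_def)
  define G where "G \<mu> = (2 * \<mu> + 1) * shoot (2 * k) \<mu> (Suc l) - shoot (2 * k) \<mu> l" for \<mu>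
  have "\<theta> < pi / 2"
    unfolding \<theta>_def by (rule divide_strict_left_mono) (use k in auto)
  moreover have \<theta>0: "0 < \<theta>" using k by (simp add: \<theta>_def)
  ultimately have \<mu>0: "0 < cos \<theta>" "cos \<theta> < 1"
    using cos_monotone_0_pi[of 0 \<theta>] by (auto intro: cos_gt_zero)
  have \<mu>1: "1 / 3 \<le> cos \<theta>"
  using small_angle_cos_ge[OF k, of \<theta>] \<theta>0 by (simp add: \<theta>_def)
  let ?g = "shoot (2 * k) (cos \<theta>)"
  obtain m where m: "2 * k = Suc m" using k by (cases k) auto
  \<comment> \<open>The indices \<open>m = 2 k - 1\<close> and \<open>2 k\<close> lie symmetrically
    about the zero of the cosine, since \<open>(2 m + 1) \<theta> = pi\<close>.\<close>
  have "real (Suc m) * \<theta> = pi - real m * \<theta>"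
  proof -
    have "real (Suc m) * \<theta> + real m * \<theta> = real (Suc m + m) * \<theta>" by (simp add: algebra_simps)
    also have "Suc m + m = 4 * k - 1" using m by simp
    also have "real (4 * k - 1) * \<theta> = pi" using k by (simp add: \<theta>_def)
    finally show ?thesis by simp
  qed
  then have gS: "?g (Suc m) = - ?g m"
    using shoot_cos[of "Suc m" "2 * k" \<theta>] shoot_cos[of m "2 * k" \<theta>] m by simp
  have gm: "0 < ?g m"
  proof -
    have "real m * \<theta> < pi / 2"
      using \<open>real (Suc m) * \<theta> = pi - real m * \<theta>\<close> \<theta>0 by (simp add: algebra_simps)
    then have "0 < cos (real m * \<theta>)"
      using \<theta>0 by (intro cos_gt_zero_pi) (auto intro: less_le_trans[of _ 0])
    then show ?thesis using shoot_cos[of m "2 * k" \<theta>] m by simp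
  qed
  have dec: "m \<le> i \<Longrightarrow> ?g (Suc i) < 0 \<and> ?g (Suc i) \<le> ?g i" for i
  proof (induction i rule: nat_induct_at_least)
    case base
    then show ?case using gS gm by simp
  next
    case (Suc i)
    \<comment> \<open>Mirror image of the growth in \<open>ladder_backward_minus\<close>: a negative
      value is multiplied by a factor of at least 2.\<close>
    have "(3 * cos \<theta> + 1) * ?g (Suc i) \<le> 2 * ?g (Suc i)"
      by (rule mult_right_mono_neg) (use \<mu>1 Suc in auto)
    moreover have "?g (Suc (Suc i)) = (3 * cos \<theta> + 1) * ?g (Suc i) - ?g i"
      using Suc m by simp
    ultimately show ?case using Suc by linarith
  qed
  have Gneg: "G (cos \<theta>) < 0"
  proof -
    have "m \<le> l" using m l k by simp
    then have "?g (Suc l) < 0" "?g (Suc l) \<le> ?g l" using dec by auto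
    then show ?thesis using \<mu>0 mult_pos_neg[of "cos \<theta>" "?g (Suc l)"]
      by (simp add: G_def algebra_simps)
  qed
  have Gpos: "0 < G 1"
    using shoot_at_1[of "2 * k" l] by (simp add: G_def)
  have "continuous_on {cos \<theta>..1} G"
    unfolding G_def
    by (intro continuous_intros continuous_on_subset[OF continuous_on_shoot]) auto
  then obtain \<mu> where \<mu>: "cos \<theta> \<le> \<mu>" "\<mu> \<le> 1" "G \<mu> = 0"
    using IVT'[of G "cos \<theta>" 0 1] Gneg Gpos \<mu>0 by auto
  have "\<mu> \<noteq> cos \<theta>" "\<mu> \<noteq> 1" using \<mu> Gneg Gpos by auto
  moreover have "chain (2 * k) (3 * k) (- 1) \<mu> (shoot (2 * k) \<mu>)"
    unfolding l[symmetric] by (rule chain_shoot) (use \<mu> k l in \<open>auto simp: G_def\<close>)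
  ultimately show thesis
    using that[of \<mu> "shoot (2 * k) \<mu>"] \<mu> by (simp add: \<theta>_def)
qed

text \<open>With a positive start the values never decrease for \<open>\<mu> = 1\<close>, while the
  last equation makes the value before the last three times the last one. This serves to show that 0
  is a simple eigenvalue for \<open>R\<close>.\<close>

lemma odd_chain_harmonic_zero:
  assumes f: "chain (2 * k) (3 * k) (- 1) 1 f" and k: "3 \<le> k" and i: "i < 3 * k"
  shows "f i = 0"
proof -
  have not_pos: "\<not> 0 < g 0" if g: "chain (2 * k) (3 * k) (- 1) 1 g" for g
  proof
    assume g0: "0 < g 0"
    have inc: "Suc i < 3 * k \<Longrightarrow> 0 < g i \<and> g i \<le> g (Suc i)" for i
    proof (induction i)
      case 0
      then show ?case using chain_first[OF g] k g0 by simp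
    next
      case (Suc i)
      then show ?case
        using chain_path_step[OF g, of i] chain_ladder_step[OF g, of i]
        by (cases "Suc i < 2 * k") auto
    qed
    define l where "l = 3 * k - 2"
    have l: "Suc (Suc l) = 3 * k" using k by (simp add: l_def)
    have "g l = 3 * g (Suc l)"
      using chain_last[OF g _ l] k by (simp add: l_def)
    then show False using inc[of l] l by auto
  qed
  from not_pos[OF f] not_pos[OF chain_scale[OF f, of "- 1"]] have "f 0 = 0" by simp
  then show ?thesis using chain_eq_zero[OF f _ _ _ i] k by simp
qed

section \<open>Normalized Laplacians\<close>

text \<open>Eigenfunctions of the random walk operator \<open>D^-1 W\<close> for the eigenvalue
  \<open>\<mu>\<close>, written without division; the zero function is allowed.\<close>

definition walk_eigenfunction :: "real mat \<Rightarrow> real \<Rightarrow> (nat \<Rightarrow> real) \<Rightarrow> bool" where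
  "walk_eigenfunction W \<mu> f \<longleftrightarrow>
     (\<forall>i<dim_row W. (\<Sum>j = 0..<dim_row W. W $$ (i, j) * f j) = \<mu> * wdegree W i * f i)"

text \<open>
  The substitution \<open>U i = sqrt (d i) * f i\<close> turns eigenvectors \<open>U\<close> of the normalized Laplacian for \<open>e\<close>
  into nonzero solutions \<open>f\<close> of \<open>W f = (1 - e) D f\<close>.
\<close>

locale positive_degree_graph =
  fixes W :: "real mat" and N :: nat
  assumes weights: "weight_matrix W" and dim: "dim_row W = N"
    and degree_pos: "\<And>i. i < N \<Longrightarrow> 0 < wdegree W i"
begin

abbreviation "L \<equiv> normalized_laplacian W"

lemma L_carrier: "L \<in> carrier_mat N N"
  using weights dim by (intro normalized_laplacian_dims) (auto simp: weight_matrix_def)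

lemma W_sym: "i < N \<Longrightarrow> j < N \<Longrightarrow> W $$ (i, j) = W $$ (j, i)"
  and W_nonneg: "i < N \<Longrightarrow> j < N \<Longrightarrow> 0 \<le> W $$ (i, j)"
  using weights dim by (auto simp: weight_matrix_def)

lemma wdegree_eq: "wdegree W i = (\<Sum>j = 0..<N. W $$ (i, j))"
  by (simp add: wdegree_def verts_def dim)

lemma L_entry:
  assumes "i < N" "j < N"
  shows "L $$ (i, j) = (if i = j then 1 else 0) - W $$ (i, j) / (sqrt (wdegree W i) * sqrt (wdegree W j))"
  using normalized_laplacian_entry[OF weights, of i j] assms degree_pos[of i] dim
  by (auto simp: real_sqrt_mult)

lemma L_sym:
  assumes "i < N" "j < N"
  shows "L $$ (i, j) = L $$ (j, i)"
  using assms W_sym by (auto simp: L_entry mult.commute)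

text \<open>One computation serves both directions of the substitution \<open>U = D^(1/2) f\<close>:
  the inner factor \<open>D^(-1/2)\<close> of the Laplacian cancels.\<close>

lemma L_sum:
  assumes i: "i < N" and u: "\<And>l. l < N \<Longrightarrow> u l = sqrt (wdegree W l) * f l"
  shows "(\<Sum>l = 0..<N. L $$ (i, l) * u l) =
    sqrt (wdegree W i) * f i - (\<Sum>l = 0..<N. W $$ (i, l) * f l) / sqrt (wdegree W i)"
proof -
  have "(\<Sum>l = 0..<N. L $$ (i, l) * u l) =
      (\<Sum>l = 0..<N. (if l = i then sqrt (wdegree W l) * f l else 0) - W $$ (i, l) * f l / sqrt (wdegree W i))"
  proof (intro sum.cong refl)
    fix l assume "l \<in> {0..<N}"
    then have l: "l < N" by simp
    have "sqrt (wdegree W l) \<noteq> 0" "sqrt (wdegree W i) \<noteq> 0"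
      using degree_pos[OF l] degree_pos[OF i] by auto
    then show "L $$ (i, l) * u l = (if l = i then sqrt (wdegree W l) * f l else 0)
        - W $$ (i, l) * f l / sqrt (wdegree W i)"
      unfolding L_entry[OF i l] u[OF l] by (auto simp: left_diff_distrib)
  qed
  also have "\<dots> = sqrt (wdegree W i) * f i - (\<Sum>l = 0..<N. W $$ (i, l) * f l / sqrt (wdegree W i))"
    using i by (simp add: sum_subtractf)
  finally show ?thesis by (simp add: sum_divide_distrib)
qed

lemma eigenvector_imp_walk_eigenfunction:
  assumes U: "eigenvector L U e"
  shows "walk_eigenfunction W (1 - e) (\<lambda>i. U $ i / sqrt (wdegree W i))"
  unfolding walk_eigenfunction_def dim
proof (intro allI impI)
  fix i assume i: "i < N"
  let ?f = "\<lambda>i. U $ i / sqrt (wdegree W i)" and ?d = "sqrt (wdegree W i)"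
  have d: "?d > 0" "wdegree W i = ?d * ?d" using degree_pos[OF i] by auto
  have "e * U $ i = ?d * ?f i - (\<Sum>l = 0..<N. W $$ (i, l) * ?f l) / ?d"
    unfolding eigenvector_entry[OF L_carrier U i, symmetric]
    by (rule L_sum[OF i]) (use degree_pos in \<open>auto simp: less_imp_neq[symmetric]\<close>)
  then have "(\<Sum>l = 0..<N. W $$ (i, l) * ?f l) = (1 - e) * ?d * U $ i"
    using d(1) by (simp add: field_simps)
  also have "\<dots> = (1 - e) * (?d * ?d) * ?f i"
    using d(1) by (simp del: real_sqrt_mult_self)
  finally show "(\<Sum>l = 0..<N. W $$ (i, l) * ?f l) = (1 - e) * wdegree W i * ?f i"
    using d(2) by simp
qed

lemma walk_eigenfunction_imp_eigenvector:
  assumes f: "walk_eigenfunction W (1 - e) f" and i: "i < N" "f i \<noteq> 0"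
  shows "eigenvector L (vec N (\<lambda>i. sqrt (wdegree W i) * f i)) e"
proof (rule eigenvectorI[OF L_carrier])
  let ?U = "vec N (\<lambda>i. sqrt (wdegree W i) * f i)"
  have "?U $ i \<noteq> 0" using i degree_pos[OF i(1)] by simp
  then show "?U \<noteq> 0\<^sub>v N" using i(1) by (metis index_zero_vec(1))
  fix j assume j: "j < N"
  let ?d = "sqrt (wdegree W j)"
  have d: "?d > 0" "wdegree W j = ?d * ?d" using degree_pos[OF j] by auto
  have "(\<Sum>l = 0..<N. L $$ (j, l) * ?U $ l) = ?d * f j - (\<Sum>l = 0..<N. W $$ (j, l) * f l) / ?d"
    by (rule L_sum[OF j]) simp
  also have "(\<Sum>l = 0..<N. W $$ (j, l) * f l) = (1 - e) * (?d * ?d) * f j"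
    using f j d(2) by (simp add: walk_eigenfunction_def dim)
  also have "?d * f j - \<dots> / ?d = e * (?d * f j)"
    using d(1) by (simp add: field_simps)
  finally show "(\<Sum>l = 0..<N. L $$ (j, l) * ?U $ l) = e * ?U $ j"
    using j by simp
qed simp

lemma eigenvector_nonzero:
  assumes "eigenvector L U e"
  obtains i where "i < N" "U $ i / sqrt (wdegree W i) \<noteq> 0"
proof -
  have "U \<in> carrier_vec N" "U \<noteq> 0\<^sub>v N"
    using assms L_carrier by (auto simp: eigenvector_def)
  then obtain i where "i < N" "U $ i \<noteq> 0"
    by (metis carrier_vecD eq_vecI index_zero_vec)
  then show thesis using that[of i] degree_pos[of i] by simp
qed

text \<open>Compare both sides of \<open>W f = (1 - e) D f\<close> at a vertex where \<open>|f|\<close> is largest.\<close>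

lemma eigenvalue_nonneg:
  assumes "eigenvalue L e"
  shows "0 \<le> e"
proof (rule ccontr)
  assume neg: "\<not> 0 \<le> e"
  obtain U where U: "eigenvector L U e" using assms by (auto simp: eigenvalue_def)
  define f where "f i = U $ i / sqrt (wdegree W i)" for i
  have f: "walk_eigenfunction W (1 - e) f"
    using eigenvector_imp_walk_eigenfunction[OF U] by (simp add: f_def[abs_def])
  obtain j where j: "j < N" "f j \<noteq> 0"
    using eigenvector_nonzero[OF U] by (auto simp: f_def)
  have "Max ((\<lambda>i. \<bar>f i\<bar>) ` {0..<N}) \<in> (\<lambda>i. \<bar>f i\<bar>) ` {0..<N}"
    by (rule Max_in) (use j in auto)
  then obtain i where i: "i < N" and "\<bar>f i\<bar> = Max ((\<lambda>i. \<bar>f i\<bar>) ` {0..<N})"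
    by auto
  then have imax: "\<bar>f l\<bar> \<le> \<bar>f i\<bar>" if "l < N" for l
    using that by simp
  have fi: "0 < \<bar>f i\<bar>" using imax[OF j(1)] j(2) by linarith
  have "\<bar>(1 - e) * wdegree W i * f i\<bar> = \<bar>\<Sum>l = 0..<N. W $$ (i, l) * f l\<bar>"
    using f i by (simp add: walk_eigenfunction_def dim)
  also have "\<dots> \<le> (\<Sum>l = 0..<N. \<bar>W $$ (i, l) * f l\<bar>)"
    by (rule sum_abs)
  also have "\<dots> \<le> (\<Sum>l = 0..<N. W $$ (i, l) * \<bar>f i\<bar>)"
    by (intro sum_mono) (use i imax W_nonneg in \<open>auto simp: abs_mult intro!: mult_left_mono\<close>)
  also have "\<dots> = wdegree W i * \<bar>f i\<bar>"
    by (simp add: wdegree_eq sum_distrib_right)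
  finally have "(1 - e) * (wdegree W i * \<bar>f i\<bar>) \<le> 1 * (wdegree W i * \<bar>f i\<bar>)"
    using neg degree_pos[OF i] by (simp add: abs_mult)
  moreover have "0 < wdegree W i * \<bar>f i\<bar>" using fi degree_pos[OF i] by simp
  ultimately have "1 - e \<le> 1" by (simp only: mult_le_cancel_right_pos)
  then show False using neg by simp
qed

text \<open>Constants are harmonic, so 0 is an eigenvalue. The hypothesis \<open>harmonic\<close>
  says that harmonic functions are determined at vertex 0, which makes 0 simple, and
  \<open>lambda2_least_nonzero_eigenvalue\<close> applies.\<close>

lemma lambda2_characterization:
  assumes N: "2 \<le> N"
    and harmonic: "\<forall>f. walk_eigenfunction W 1 f \<and> f 0 = 0 \<longrightarrow> (\<forall>i<N. f i = 0)"
  shows lambda2_pos: "0 < lambda2 L"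
    and lambda2_eigenfunction: "\<exists>f. walk_eigenfunction W (1 - lambda2 L) f \<and> (\<exists>i<N. f i \<noteq> 0)"
    and lambda2_le: "\<And>e f i. walk_eigenfunction W (1 - e) f \<Longrightarrow> i < N \<Longrightarrow> f i \<noteq> 0 \<Longrightarrow> e \<noteq> 0 \<Longrightarrow> lambda2 L \<le> e"
    and lambda2_eigenvalue: "eigenvalue L (lambda2 L)"
proof -
  have "walk_eigenfunction W (1 - 0) (\<lambda>_. 1)"
    by (simp add: walk_eigenfunction_def dim wdegree_eq)
  from walk_eigenfunction_imp_eigenvector[OF this, of 0]
  have ev0: "eigenvalue L 0" using N by (auto simp: eigenvalue_def)
  have nz: "v $ 0 \<noteq> 0" if v: "eigenvector L v 0" for v
  proof
    assume "v $ 0 = 0"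
    with harmonic[rule_format, OF conjI, OF eigenvector_imp_walk_eigenfunction[OF v, simplified]]
    have "\<And>i. i < N \<Longrightarrow> v $ i / sqrt (wdegree W i) = 0" by simp
    then show False using eigenvector_nonzero[OF v] by blast
  qed
  note l2 = lambda2_least_nonzero_eigenvalue[OF L_carrier N L_sym ev0 nz eigenvalue_nonneg]
  show "0 < lambda2 L" by (rule l2(2))
  show "eigenvalue L (lambda2 L)" by (rule l2(1))
  then obtain U where U: "eigenvector L U (lambda2 L)" by (auto simp: eigenvalue_def)
  show "\<exists>f. walk_eigenfunction W (1 - lambda2 L) f \<and> (\<exists>i<N. f i \<noteq> 0)"
    using eigenvector_imp_walk_eigenfunction[OF U] eigenvector_nonzero[OF U] by blast
  fix e f i assume "walk_eigenfunction W (1 - e) f" "i < N" "f i \<noteq> 0" "e \<noteq> 0"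
  then show "lambda2 L \<le> e"
    using walk_eigenfunction_imp_eigenvector[of e f i] l2(3)[of e] by (auto simp: eigenvalue_def)
qed

lemma cut_commute:
  assumes "A \<subseteq> {0..<N}" "B \<subseteq> {0..<N}"
  shows "cut W A B = cut W B A"
proof -
  have "cut W A B = (\<Sum>j\<in>B. \<Sum>i\<in>A. W $$ (i, j))"
    unfolding cut_def by (rule sum.swap)
  also have "\<dots> = cut W B A"
    unfolding cut_def by (intro sum.cong refl W_sym) (use assms in auto)
  finally show ?thesis .
qed

lemma Ncut_commute:
  assumes "A \<subseteq> {0..<N}" "B \<subseteq> {0..<N}"
  shows "Ncut W A B = Ncut W B A"
  using cut_commute[OF assms] by (simp add: Ncut_def add.commute)

end

lemma Mcut_le:
  assumes "A \<noteq> {}" "A \<subset> verts W"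
  shows "Mcut W \<le> Ncut W A (verts W - A)"
proof -
  have "{Ncut W A (verts W - A) | A. A \<noteq> {} \<and> A \<subset> verts W} \<subseteq>
      (\<lambda>A. Ncut W A (verts W - A)) ` Pow (verts W)" by auto
  then have "finite {Ncut W A (verts W - A) | A. A \<noteq> {} \<and> A \<subset> verts W}"
    by (rule finite_subset) (simp add: verts_def)
  then show ?thesis
    unfolding Mcut_def using assms by (intro Min_le) auto
qed

section \<open>Edges, rows and degrees of the three families of graphs\<close>

lemma sum_neighbours:
  assumes "i < M"
  shows "(\<Sum>j = 0..<M. (if j = Suc i \<or> i = Suc j then 1 else 0) * f j) = nbr_sum M f i"
proof -
  \<comment> \<open>Truncated subtraction sends \<open>i - 1\<close> to 0 when \<open>i = 0\<close>;
    the inner condition removes that term.\<close>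
  have "(\<Sum>j = 0..<M. (if j = Suc i \<or> i = Suc j then 1 else 0) * f j) =
      (\<Sum>j = 0..<M. (if j = i - 1 then (if 0 < i then f j else 0) else 0) + (if j = Suc i then f j else 0))"
    by (intro sum.cong) auto
  then show ?thesis using assms by (simp add: sum.distrib nbr_sum_def)
qed

lemma path_edge_iff:
  "{u, v} \<in> {{xv i, xv (i + 1)} | i. 1 \<le> i \<and> i < m} \<longleftrightarrow>
    (v = Suc u \<and> Suc u < m) \<or> (u = Suc v \<and> Suc v < m)" (is "?l \<longleftrightarrow> ?r")
proof
  assume ?l then show ?r by (auto simp: xv_def doubleton_eq_iff)
next
  assume ?r
  then consider "v = Suc u" "Suc u < m" | "u = Suc v" "Suc v < m" by blast
  then show ?l
  proof cases
    case 1
    then show ?thesis by (intro CollectI exI[of _ "Suc u"]) (simp add: xv_def)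
  next
    case 2
    then show ?thesis by (intro CollectI exI[of _ "Suc v"]) (simp add: xv_def insert_commute)
  qed
qed

lemma dim_path_graph [simp]: "dim_row (path_graph m) = m"
  by (simp add: path_graph_def unit_weights_def)

lemma path_graph_entry:
  assumes "u < m" "v < m"
  shows "path_graph m $$ (u, v) = (if (v = Suc u \<and> Suc u < m) \<or> (u = Suc v \<and> Suc v < m) then 1 else 0)"
  unfolding path_graph_def unit_weights_def index_mat(1)[OF assms] prod.case path_edge_iff ..

lemma path_graph_row:
  assumes "i < m"
  shows "(\<Sum>j = 0..<m. path_graph m $$ (i, j) * f j) = nbr_sum m f i"
  unfolding sum_neighbours[OF assms, symmetric]
  by (intro sum.cong) (use assms in \<open>auto simp: path_graph_entry\<close>)

lemma path_graph_degree:
  assumes "i < m"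
  shows "wdegree (path_graph m) i = chain_degree m m i"
  using path_graph_row[OF assms, of "\<lambda>_. 1"] assms
  by (simp add: wdegree_def verts_def chain_degree_def)

lemma path_graph_walk_eigenfunction:
  "walk_eigenfunction (path_graph m) \<mu> f \<longleftrightarrow> chain m m s \<mu> f"
  by (auto simp: walk_eigenfunction_def chain_def path_graph_row path_graph_degree)

lemma positive_degree_path_graph:
  assumes "2 \<le> m"
  shows "positive_degree_graph (path_graph m) m"
proof
  show "weight_matrix (path_graph m)"
    unfolding path_graph_def by (rule weight_matrix_unit_weights)
  show "0 < wdegree (path_graph m) i" if "i < m" for i
    using chain_degree_bounds(1)[OF that assms, of m] that by (simp add: path_graph_degree)
qed simp

lemma P_edge_iff:
  "{u, v} \<in> {{xv i, xv (i + 1)} | i. 1 \<le> i \<and> i < n + k} \<union> {{xv i} | i. n + 1 \<le> i \<and> i \<le> n + k} \<longleftrightarrow>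
    (v = Suc u \<and> Suc u < n + k) \<or> (u = Suc v \<and> Suc v < n + k) \<or> (u = v \<and> n \<le> u \<and> u < n + k)"
proof -
  have "{u, v} \<in> {{xv i} | i. n + 1 \<le> i \<and> i \<le> n + k} \<longleftrightarrow> u = v \<and> n \<le> u \<and> u < n + k"
    (is "?l \<longleftrightarrow> ?r")
  proof
    assume ?l then show ?r by (auto simp: xv_def)
  next
    assume ?r
    then show ?l by (intro CollectI exI[of _ "Suc u"]) (simp add: xv_def)
  qed
  then show ?thesis unfolding Un_iff path_edge_iff by (simp only: disj_assoc)
qed

lemma dim_P_graph [simp]: "dim_row (P_graph n k) = n + k"
  by (simp add: P_graph_def unit_weights_def)

lemma P_graph_entry:
  assumes "u < n + k" "v < n + k"
  shows "P_graph n k $$ (u, v) = (if (v = Suc u \<and> Suc u < n + k) \<or> (u = Suc v \<and> Suc v < n + k) \<or>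
    (u = v \<and> n \<le> u \<and> u < n + k) then 1 else 0)"
  unfolding P_graph_def unit_weights_def index_mat(1)[OF assms] prod.case P_edge_iff ..

lemma P_graph_row:
  assumes "i < n + k"
  shows "(\<Sum>j = 0..<n + k. P_graph n k $$ (i, j) * f j) = nbr_sum (n + k) f i + (if n \<le> i then f i else 0)"
proof -
  have "(\<Sum>j = 0..<n + k. P_graph n k $$ (i, j) * f j) =
      (\<Sum>j = 0..<n + k. (if j = Suc i \<or> i = Suc j then 1 else 0) * f j +
        (if j = i then (if n \<le> i then f i else 0) else 0))"
    by (intro sum.cong) (use assms in \<open>auto simp: P_graph_entry\<close>)
  then show ?thesis using assms by (simp add: sum.distrib sum_neighbours)
qed

lemma P_graph_degree:
  assumes "i < n + k"
  shows "wdegree (P_graph n k) i = chain_degree n (n + k) i"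
  using P_graph_row[OF assms, of "\<lambda>_. 1"]
  by (simp add: wdegree_def verts_def chain_degree_def)

lemma P_graph_walk_eigenfunction:
  "walk_eigenfunction (P_graph n k) \<mu> f \<longleftrightarrow> chain n (n + k) 1 \<mu> f"
  by (auto simp: walk_eigenfunction_def chain_def P_graph_row P_graph_degree)

lemma positive_degree_P_graph:
  assumes "2 \<le> n + k"
  shows "positive_degree_graph (P_graph n k) (n + k)"
proof
  show "weight_matrix (P_graph n k)"
    unfolding P_graph_def by (rule weight_matrix_unit_weights)
  show "0 < wdegree (P_graph n k) i" if "i < n + k" for i
    using chain_degree_bounds(1)[OF that assms, of n] that by (simp add: P_graph_degree)
qed simp

lemma R_edge_iff:
  fixes n k :: nat
  defines "M \<equiv> n + k"
  shows "{u, v} \<in> {{xv i, xv (i + 1)} | i. 1 \<le> i \<and> i \<le> n + k - 1} \<union>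
      {{yv n k i, yv n k (i + 1)} | i. 1 \<le> i \<and> i \<le> n + k - 1} \<union>
      {{xv i, yv n k i} | i. n + 1 \<le> i \<and> i \<le> n + k} \<longleftrightarrow>
    (v = Suc u \<and> Suc u < M) \<or> (u = Suc v \<and> Suc v < M) \<or>
    (M \<le> u \<and> v = Suc u \<and> Suc u < 2 * M) \<or> (M \<le> v \<and> u = Suc v \<and> Suc v < 2 * M) \<or>
    (n \<le> u \<and> u < M \<and> v = M + u) \<or> (n \<le> v \<and> v < M \<and> u = M + v)"
    (is "{u, v} \<in> ?X \<union> ?Y \<union> ?Z \<longleftrightarrow> _")
proof -
  have X: "{u, v} \<in> ?X \<longleftrightarrow> (v = Suc u \<and> Suc u < M) \<or> (u = Suc v \<and> Suc v < M)"
  proof -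
    have "(1 \<le> i \<and> i \<le> n + k - 1) \<longleftrightarrow> (1 \<le> i \<and> i < M)" for i
      unfolding M_def by linarith
    then show ?thesis by (simp only: path_edge_iff)
  qed
  have Y: "{u, v} \<in> ?Y \<longleftrightarrow> (M \<le> u \<and> v = Suc u \<and> Suc u < 2 * M) \<or> (M \<le> v \<and> u = Suc v \<and> Suc v < 2 * M)"
    (is "?l \<longleftrightarrow> ?r")
  proof
    assume ?l
    then obtain i where "{u, v} = {yv n k i, yv n k (i + 1)}" and i: "1 \<le> i" "i \<le> n + k - 1"
      by blast
    then have "u = M + i - 1 \<and> v = M + i \<or> u = M + i \<and> v = M + i - 1"
      by (simp add: yv_def doubleton_eq_iff M_def)
    then show ?r using i unfolding M_def[symmetric] by arith
  next
    assume ?r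
    then consider "v = Suc u" "M \<le> u" "Suc u < 2 * M" | "u = Suc v" "M \<le> v" "Suc v < 2 * M" by blast
    then show ?l
    proof cases
      case 1
      define i where "i = Suc u - M"
      have "{u, v} = {yv n k i, yv n k (i + 1)}" "1 \<le> i" "i \<le> n + k - 1"
        using 1 by (auto simp: yv_def i_def M_def)
      then show ?thesis by blast
    next
      case 2
      define i where "i = Suc v - M"
      have "{u, v} = {yv n k i, yv n k (i + 1)}" "1 \<le> i" "i \<le> n + k - 1"
        using 2 by (auto simp: yv_def i_def M_def)
      then show ?thesis by blast
    qed
  qed
  have Z: "{u, v} \<in> ?Z \<longleftrightarrow> (n \<le> u \<and> u < M \<and> v = M + u) \<or> (n \<le> v \<and> v < M \<and> u = M + v)"
    (is "?l \<longleftrightarrow> ?r")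
  proof
    assume ?l
    then obtain i where "{u, v} = {xv i, yv n k i}" and i: "n + 1 \<le> i" "i \<le> n + k"
      by blast
    then have "u = i - 1 \<and> v = M + i - 1 \<or> u = M + i - 1 \<and> v = i - 1"
      by (simp add: xv_def yv_def doubleton_eq_iff M_def)
    then show ?r using i unfolding M_def[symmetric] by arith
  next
    assume ?r
    then consider "n \<le> u" "u < M" "v = M + u" | "n \<le> v" "v < M" "u = M + v" by blast
    then show ?l
    proof cases
      case 1
      then have "{u, v} = {xv (Suc u), yv n k (Suc u)}" "n + 1 \<le> Suc u" "Suc u \<le> n + k"
        by (auto simp: xv_def yv_def M_def)
      then show ?thesis by blast
    next
      case 2
      then have "{u, v} = {xv (Suc v), yv n k (Suc v)}" "n + 1 \<le> Suc v" "Suc v \<le> n + k"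
        by (auto simp: xv_def yv_def M_def)
      then show ?thesis by blast
    qed
  qed
  show ?thesis unfolding Un_iff X Y Z by (simp only: disj_assoc)
qed

lemma dim_R_graph [simp]: "dim_row (R_graph n k) = 2 * (n + k)"
  by (simp add: R_graph_def unit_weights_def)

lemma R_graph_entry:
  fixes n k :: nat
  defines "M \<equiv> n + k"
  assumes "u < 2 * M" "v < 2 * M"
  shows "R_graph n k $$ (u, v) = (if (v = Suc u \<and> Suc u < M) \<or> (u = Suc v \<and> Suc v < M) \<or>
    (M \<le> u \<and> v = Suc u \<and> Suc u < 2 * M) \<or> (M \<le> v \<and> u = Suc v \<and> Suc v < 2 * M) \<or>
    (n \<le> u \<and> u < M \<and> v = M + u) \<or> (n \<le> v \<and> v < M \<and> u = M + v) then 1 else 0)"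
  unfolding R_graph_def unit_weights_def index_mat(1)[OF assms(2,3)[unfolded M_def]] prod.case R_edge_iff M_def ..

lemma R_graph_index:
  assumes "i < n + k" "j < n + k"
  shows "R_graph n k $$ (i, j) = (if j = Suc i \<or> i = Suc j then 1 else 0)"
    and "R_graph n k $$ (n + k + i, n + k + j) = (if j = Suc i \<or> i = Suc j then 1 else 0)"
    and "R_graph n k $$ (i, n + k + j) = (if j = i \<and> n \<le> i then 1 else 0)"
    and "R_graph n k $$ (n + k + i, j) = (if j = i \<and> n \<le> i then 1 else 0)"
proof -
  have lt: "i < 2 * (n + k)" "j < 2 * (n + k)" "n + k + i < 2 * (n + k)" "n + k + j < 2 * (n + k)"
    using assms by auto
  show "R_graph n k $$ (i, j) = (if j = Suc i \<or> i = Suc j then 1 else 0)"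
    unfolding R_graph_entry[OF lt(1,2)] using assms by simp
  show "R_graph n k $$ (n + k + i, n + k + j) = (if j = Suc i \<or> i = Suc j then 1 else 0)"
    unfolding R_graph_entry[OF lt(3,4)] using assms by simp
  show "R_graph n k $$ (i, n + k + j) = (if j = i \<and> n \<le> i then 1 else 0)"
    unfolding R_graph_entry[OF lt(1,4)] using assms by simp
  show "R_graph n k $$ (n + k + i, j) = (if j = i \<and> n \<le> i then 1 else 0)"
    unfolding R_graph_entry[OF lt(3,2)] using assms by simp
qed

lemma sum_upper_half:
  fixes g :: "nat \<Rightarrow> 'a::comm_monoid_add"
  shows "(\<Sum>j = M..<2 * M. g j) = (\<Sum>j = 0..<M. g (M + j))"
  using sum.shift_bounds_nat_ivl[of g 0 M M] by (simp add: mult_2 add.commute)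

lemma sum_double:
  fixes g :: "nat \<Rightarrow> 'a::comm_monoid_add"
  shows "(\<Sum>j = 0..<2 * M. g j) = (\<Sum>j = 0..<M. g j) + (\<Sum>j = 0..<M. g (M + j))"
  unfolding sum_upper_half[symmetric] by (rule sum.atLeastLessThan_concat[symmetric]) auto

lemma R_graph_row:
  assumes i: "i < n + k"
  shows "(\<Sum>j = 0..<2 * (n + k). R_graph n k $$ (i, j) * f j) =
      nbr_sum (n + k) f i + (if n \<le> i then f (n + k + i) else 0)"
    and "(\<Sum>j = 0..<2 * (n + k). R_graph n k $$ (n + k + i, j) * f j) =
      nbr_sum (n + k) (\<lambda>j. f (n + k + j)) i + (if n \<le> i then f i else 0)"
proof -
  let ?M = "n + k"
  have nbr: "(\<Sum>j = 0..<?M. R_graph n k $$ (i, j) * g j) = nbr_sum ?M g i"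
    "(\<Sum>j = 0..<?M. R_graph n k $$ (?M + i, ?M + j) * g j) = nbr_sum ?M g i" for g
    unfolding sum_neighbours[OF i, symmetric]
    by (intro sum.cong; simp add: R_graph_index i)+
  have rung: "(\<Sum>j = 0..<?M. R_graph n k $$ (i, ?M + j) * g j) = (if n \<le> i then g i else 0)"
    "(\<Sum>j = 0..<?M. R_graph n k $$ (?M + i, j) * g j) = (if n \<le> i then g i else 0)" for g
  proof -
    have "(\<Sum>j = 0..<?M. if j = i then (if n \<le> i then g i else 0) else 0) = (if n \<le> i then g i else 0)"
      using i by simp
    moreover have "(\<Sum>j = 0..<?M. R_graph n k $$ (i, ?M + j) * g j) =
        (\<Sum>j = 0..<?M. if j = i then (if n \<le> i then g i else 0) else 0)"
      "(\<Sum>j = 0..<?M. R_graph n k $$ (?M + i, j) * g j) =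
        (\<Sum>j = 0..<?M. if j = i then (if n \<le> i then g i else 0) else 0)"
      by (intro sum.cong; simp add: R_graph_index i)+
    ultimately show "(\<Sum>j = 0..<?M. R_graph n k $$ (i, ?M + j) * g j) = (if n \<le> i then g i else 0)"
      "(\<Sum>j = 0..<?M. R_graph n k $$ (?M + i, j) * g j) = (if n \<le> i then g i else 0)"
      by simp_all
  qed
  show "(\<Sum>j = 0..<2 * ?M. R_graph n k $$ (i, j) * f j) = nbr_sum ?M f i + (if n \<le> i then f (?M + i) else 0)"
    unfolding sum_double nbr rung ..
  show "(\<Sum>j = 0..<2 * ?M. R_graph n k $$ (?M + i, j) * f j) =
      nbr_sum ?M (\<lambda>j. f (?M + j)) i + (if n \<le> i then f i else 0)"
    unfolding sum_double nbr rung by (rule add.commute)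
qed

lemma R_graph_degree:
  assumes "i < n + k"
  shows "wdegree (R_graph n k) i = chain_degree n (n + k) i"
    and "wdegree (R_graph n k) (n + k + i) = chain_degree n (n + k) i"
  using R_graph_row[OF assms, of "\<lambda>_. 1"]
  by (simp_all add: wdegree_def verts_def chain_degree_def)

lemma nbr_sum_linear:
  "nbr_sum M (\<lambda>i. f i + g i) i = nbr_sum M f i + nbr_sum M g i"
  "nbr_sum M (\<lambda>i. f i - g i) i = nbr_sum M f i - nbr_sum M g i"
  by (simp_all add: nbr_sum_def)

text \<open>Adding and subtracting the equations at \<open>x_i\<close> and \<open>y_i\<close>
  decouples them: the rung, which links the two copies, becomes a loop term of sign \<open>1\<close>
  for sums and \<open>-1\<close> for differences.\<close>

lemma R_graph_walk_eigenfunctionD: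
  assumes f: "walk_eigenfunction (R_graph n k) \<mu> f"
  shows "chain n (n + k) 1 \<mu> (\<lambda>i. f i + f (n + k + i))"
    and "chain n (n + k) (- 1) \<mu> (\<lambda>i. f i - f (n + k + i))"
proof -
  let ?M = "n + k"
  have x: "nbr_sum ?M f i + (if n \<le> i then f (?M + i) else 0) = \<mu> * chain_degree n ?M i * f i"
    if "i < ?M" for i
    using f that R_graph_row(1)[OF that, of f] by (simp add: walk_eigenfunction_def R_graph_degree)
  have y: "nbr_sum ?M (\<lambda>j. f (?M + j)) i + (if n \<le> i then f i else 0) =
      \<mu> * chain_degree n ?M i * f (?M + i)" if "i < ?M" for i
  proof -
    have "?M + i < dim_row (R_graph n k)" using that by simp
    then show ?thesis
      using f that R_graph_row(2)[OF that, of f]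
      by (simp add: walk_eigenfunction_def R_graph_degree del: dim_R_graph) (simp add: R_graph_degree)
  qed
  show "chain n ?M 1 \<mu> (\<lambda>i. f i + f (?M + i))"
    unfolding chain_def nbr_sum_linear
  proof (intro allI impI)
    fix i assume i: "i < ?M"
    show "nbr_sum ?M f i + nbr_sum ?M (\<lambda>i. f (?M + i)) i + (if n \<le> i then 1 * (f i + f (?M + i)) else 0) =
        \<mu> * chain_degree n ?M i * (f i + f (?M + i))"
      using x[OF i] y[OF i] by (cases "n \<le> i"; simp add: ring_distribs; linarith)
  qed
  show "chain n ?M (- 1) \<mu> (\<lambda>i. f i - f (?M + i))"
    unfolding chain_def nbr_sum_linear
  proof (intro allI impI)
    fix i assume i: "i < ?M"
    show "nbr_sum ?M f i - nbr_sum ?M (\<lambda>i. f (?M + i)) i + (if n \<le> i then - 1 * (f i - f (?M + i)) else 0) =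
        \<mu> * chain_degree n ?M i * (f i - f (?M + i))"
      using x[OF i] y[OF i] by (cases "n \<le> i"; simp add: ring_distribs; linarith)
  qed
qed

text \<open>In the antisymmetric extension the neighbour across a rung carries the opposite value,
  which is the loop term for \<open>s = -1\<close>.\<close>

lemma R_graph_odd_walk_eigenfunction:
  assumes g: "chain n (n + k) (- 1) \<mu> g"
  shows "walk_eigenfunction (R_graph n k) \<mu> (\<lambda>i. if i < n + k then g i else - g (i - (n + k)))"
    (is "walk_eigenfunction _ _ ?f")
  unfolding walk_eigenfunction_def dim_R_graph
proof (intro allI impI)
  let ?M = "n + k"
  fix i assume i: "i < 2 * ?M"
  have nbr: "nbr_sum ?M ?f j = nbr_sum ?M g j" "nbr_sum ?M (\<lambda>j. ?f (?M + j)) j = - nbr_sum ?M g j"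
    if "j < ?M" for j
    using that by (auto simp: nbr_sum_def)
  have chain: "nbr_sum ?M g j + (if n \<le> j then - g j else 0) = \<mu> * chain_degree n ?M j * g j"
    if "j < ?M" for j
    using g that by (auto simp: chain_def)
  show "(\<Sum>j = 0..<2 * ?M. R_graph n k $$ (i, j) * ?f j) = \<mu> * wdegree (R_graph n k) i * ?f i"
  proof (cases "i < ?M")
    case True
    then show ?thesis
      unfolding R_graph_row(1)[OF True] R_graph_degree(1)[OF True] nbr[OF True]
      using chain[OF True] True by (auto split: if_splits)
  next
    case False
    define j where "j = i - ?M"
    have j: "j < ?M" "i = ?M + j" using False i by (auto simp: j_def)
    show ?thesis
      unfolding j(2) R_graph_row(2)[OF j(1)] R_graph_degree(2)[OF j(1)] nbr[OF j(1)]
      using chain[OF j(1)] j(1) by (auto split: if_splits)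
  qed
qed

lemma positive_degree_R_graph:
  assumes "2 \<le> n + k"
  shows "positive_degree_graph (R_graph n k) (2 * (n + k))"
proof
  show "weight_matrix (R_graph n k)"
    unfolding R_graph_def by (rule weight_matrix_unit_weights)
  show "0 < wdegree (R_graph n k) i" if "i < 2 * (n + k)" for i
  proof (cases "i < n + k")
    case True
    then show ?thesis using chain_degree_bounds(1)[OF True assms, of n] by (simp add: R_graph_degree)
  next
    case False
    define j where "j = i - (n + k)"
    have j: "j < n + k" "i = n + k + j" using False that by (auto simp: j_def)
    then show ?thesis using chain_degree_bounds(1)[OF j(1) assms, of n] by (simp add: R_graph_degree)
  qed
qed simp

section \<open>Second eigenvalues and cuts\<close>

text \<open>Turns an eigenvalue \<open>1 - \<mu>\<close> in \<open>(0, 1 - cos t]\<close> into an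
  angle in \<open>(0, t]\<close>, where the chain results apply.\<close>

lemma obtain_angle:
  fixes \<mu> t :: real
  assumes "cos t \<le> \<mu>" "\<mu> < 1" "0 \<le> t" "t \<le> pi"
  obtains \<theta> where "0 < \<theta>" "\<theta> \<le> t" "\<mu> = cos \<theta>"
proof (rule that)
  have \<mu>: "- 1 \<le> \<mu>" using assms(1) cos_ge_minus_one[of t] by linarith
  show "\<mu> = cos (arccos \<mu>)" using \<mu> assms by simp
  show "0 < arccos \<mu>" using arccos_less_arccos[of \<mu> 1] \<mu> assms by simp
  have "arccos \<mu> \<le> arccos (cos t)"
    by (rule arccos_le_arccos) (use assms in auto)
  then show "arccos \<mu> \<le> t" using assms by (simp add: arccos_cos)
qed

text \<open>The eigenfunction \<open>cos (i t)\<close> bounds \<open>lambda2\<close> from above.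
  Anything smaller would have an angle strictly between 0 and \<open>t\<close>, where
  \<open>chain_path_small_angle\<close> and \<open>chain_eq_zero\<close> leave only the zero
  function.\<close>

lemma lambda2_path_graph:
  assumes m: "2 \<le> m"
  shows "lambda2 (normalized_laplacian (path_graph m)) = 1 - cos (pi / real (m - 1))"
proof -
  interpret positive_degree_graph "path_graph m" m
    by (rule positive_degree_path_graph[OF m])
  note walk = path_graph_walk_eigenfunction[of m _ _ 1]
  have m1: "1 \<le> m" using m by simp
  have harmonic: "\<forall>f. walk_eigenfunction (path_graph m) 1 f \<and> f 0 = 0 \<longrightarrow> (\<forall>i<m. f i = 0)"
    unfolding walk using chain_eq_zero[OF _ m1 m] by blast
  note l2 = lambda2_characterization[OF m harmonic]
  define t where "t = pi / real (m - 1)"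
  have t: "real (m - 1) * t = pi" "0 < t" using m by (auto simp: t_def)
  have "pi / real (m - 1) \<le> pi / 1"
    by (rule divide_left_mono) (use m in auto)
  then have t_pi: "t \<le> pi" by (simp add: t_def)
  have cos_t: "cos t < 1" using cos_monotone_0_pi[of 0 t] t t_pi by simp
  have "lambda2 L \<le> 1 - cos t"
    by (rule l2(3)[of "1 - cos t" "\<lambda>i. cos (real i * t)" 0])
      (use chain_path_cos[OF m t(1)] m cos_t in \<open>auto simp: walk\<close>)
  moreover have "\<not> lambda2 L < 1 - cos t"
  proof
    assume less: "lambda2 L < 1 - cos t"
    then obtain \<theta> where \<theta>: "0 < \<theta>" "\<theta> \<le> t" "1 - lambda2 L = cos \<theta>"
      using obtain_angle[of t "1 - lambda2 L"] l2(1) t t_pi by auto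
    have "\<theta> \<noteq> t" using less \<theta> by auto
    then have "real (m - 1) * \<theta> < real (m - 1) * t"
      using \<theta> m by (intro mult_strict_left_mono) auto
    then have \<theta>': "real (m - 1) * \<theta> < pi" unfolding t(1) .
    obtain f i where f: "walk_eigenfunction (path_graph m) (cos \<theta>) f" and i: "i < m" "f i \<noteq> 0"
      using l2(2) \<theta> by auto
    have "f 0 = 0"
      by (rule chain_path_small_angle[OF f[unfolded walk] m \<theta>(1) \<theta>'])
    then show False using chain_eq_zero[OF f[unfolded walk] m1 m _ i(1)] i by simp
  qed
  ultimately show ?thesis by (simp add: t_def)
qed

text \<open>Otherwise there is a nonzero eigenfunction with angle in \<open>(0, t]\<close>; the
  loops of \<open>P\<close> are the case \<open>s = 1\<close>, so \<open>even_chain_zero\<close>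
  makes it vanish.\<close>

lemma lambda2_P_graph_gt:
  assumes k: "3 \<le> k"
  shows "1 - cos (pi / real (4 * k - 1)) < lambda2 (normalized_laplacian (P_graph (2 * k) k))"
proof (rule ccontr)
  have nk: "2 \<le> 2 * k + k" "1 \<le> 2 * k" "2 * k + k = 3 * k" using k by auto
  interpret positive_degree_graph "P_graph (2 * k) k" "2 * k + k"
    by (rule positive_degree_P_graph[OF nk(1)])
  note walk = P_graph_walk_eigenfunction[of "2 * k" k]
  have harmonic: "\<forall>f. walk_eigenfunction (P_graph (2 * k) k) 1 f \<and> f 0 = 0 \<longrightarrow> (\<forall>i<2 * k + k. f i = 0)"
    unfolding walk using chain_eq_zero[OF _ nk(2,1)] by blast
  note l2 = lambda2_characterization[OF nk(1) harmonic]
  define t where "t = pi / real (4 * k - 1)"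
  have "pi / real (4 * k - 1) \<le> pi / 1"
    by (rule divide_left_mono) (use k in auto)
  then have t: "0 \<le> t" "t \<le> pi" by (auto simp: t_def)
  assume "\<not> 1 - cos (pi / real (4 * k - 1)) < lambda2 L"
  then obtain \<theta> where \<theta>: "0 < \<theta>" "\<theta> \<le> t" "1 - lambda2 L = cos \<theta>"
    using obtain_angle[of t "1 - lambda2 L"] l2(1) t by (auto simp: t_def)
  obtain f i where f: "walk_eigenfunction (P_graph (2 * k) k) (cos \<theta>) f"
    and i: "i < 2 * k + k" "f i \<noteq> 0"
    using l2(2) \<theta> by auto
  have "f i = 0"
    by (rule even_chain_zero[OF _ k \<theta>(1)])
      (use f i \<theta>(2) in \<open>simp_all add: walk t_def nk(3)\<close>)
  with i show False by simp
qed

text \<open>The odd part vanishes by \<open>odd_chain_harmonic_zero\<close>; then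
  \<open>f 0 = 0\<close> makes the even part start at 0, so it vanishes too.\<close>

lemma harmonic_R_graph:
  assumes k: "3 \<le> k"
  shows "\<forall>f. walk_eigenfunction (R_graph (2 * k) k) 1 f \<and> f 0 = 0 \<longrightarrow> (\<forall>i<2 * (2 * k + k). f i = 0)"
proof (intro allI impI, elim conjE)
  fix f :: "nat \<Rightarrow> real" and i
  assume f: "walk_eigenfunction (R_graph (2 * k) k) 1 f" and f0: "f 0 = 0" and i: "i < 2 * (2 * k + k)"
  have nk: "2 * k + k = 3 * k" by simp
  note chains = R_graph_walk_eigenfunctionD[OF f, unfolded nk]
  have odd: "f j = f (3 * k + j)" if "j < 3 * k" for j
    using odd_chain_harmonic_zero[OF chains(2) k that] by simp
  have even: "f j + f (3 * k + j) = 0" if "j < 3 * k" for j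
    by (rule chain_eq_zero[OF chains(1) _ _ _ that]) (use odd[of 0] f0 k in auto)
  have zero: "f j = 0 \<and> f (3 * k + j) = 0" if "j < 3 * k" for j
    using odd[OF that] even[OF that] by simp
  show "f i = 0"
    using zero[of i] zero[of "i - 3 * k"] i by (cases "i < 3 * k") auto
qed

lemma lambda2_R_graph_lt:
  assumes k: "3 \<le> k"
  shows "lambda2 (normalized_laplacian (R_graph (2 * k) k)) < 1 - cos (pi / real (4 * k - 1))"
proof -
  have nk: "2 \<le> 2 * k + k" "2 \<le> 2 * (2 * k + k)" "2 * k + k = 3 * k" using k by auto
  interpret positive_degree_graph "R_graph (2 * k) k" "2 * (2 * k + k)"
    by (rule positive_degree_R_graph[OF nk(1)])
  note l2 = lambda2_characterization[OF nk(2) harmonic_R_graph[OF k]]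
  obtain \<mu> g where g: "cos (pi / real (4 * k - 1)) < \<mu>" "\<mu> < 1"
    "chain (2 * k) (3 * k) (- 1) \<mu> g" "g 0 = 1"
    by (rule exists_odd_chain[OF k])
  have g': "chain (2 * k) (2 * k + k) (- 1) (1 - (1 - \<mu>)) g" using g(3) by (simp add: nk(3))
  have "lambda2 L \<le> 1 - \<mu>"
    by (rule l2(3)[OF R_graph_odd_walk_eigenfunction[OF g'], of 0]) (use k g in auto)
  then show ?thesis using g(1) by simp
qed

text \<open>By \<open>lambda2_R_graph_lt\<close> the angle lies in the range where
  \<open>even_chain_zero\<close> removes the even part. The odd part is twice \<open>f\<close> on
  the \<open>x\<close> side, and \<open>chain_positive\<close> fixes its sign there. Square roots of
  degrees are positive and agree on \<open>x_i\<close> and \<open>y_i\<close>, so both facts pass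
  from \<open>f\<close> to \<open>U\<close>.\<close>

lemma R_graph_lambda2_eigenvector:
  assumes k: "3 \<le> k"
    and U: "eigenvector (normalized_laplacian (R_graph (2 * k) k)) U
      (lambda2 (normalized_laplacian (R_graph (2 * k) k)))"
  shows "\<And>i. i < 3 * k \<Longrightarrow> U $ (3 * k + i) = - U $ i"
    and "(\<forall>i<3 * k. 0 < U $ i) \<or> (\<forall>i<3 * k. U $ i < 0)"
proof -
  have nk: "2 \<le> 2 * k + k" "2 \<le> 2 * (2 * k + k)" "2 * k + k = 3 * k" using k by auto
  interpret positive_degree_graph "R_graph (2 * k) k" "2 * (2 * k + k)"
    by (rule positive_degree_R_graph[OF nk(1)])
  note l2 = lambda2_characterization[OF nk(2) harmonic_R_graph[OF k]]
  define t where "t = pi / real (4 * k - 1)"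
  have "pi / real (4 * k - 1) \<le> pi / 1"
    by (rule divide_left_mono) (use k in auto)
  then have t: "0 \<le> t" "t \<le> pi" by (auto simp: t_def)
  obtain \<theta> where \<theta>: "0 < \<theta>" "\<theta> \<le> t" "1 - lambda2 L = cos \<theta>"
    using obtain_angle[of t "1 - lambda2 L"] l2(1) t lambda2_R_graph_lt[OF k] by (auto simp: t_def)
  define f where "f i = U $ i / sqrt (wdegree (R_graph (2 * k) k) i)" for i
  have f: "walk_eigenfunction (R_graph (2 * k) k) (cos \<theta>) f"
    using eigenvector_imp_walk_eigenfunction[OF U] \<theta>(3) by (simp add: f_def[abs_def])
  note chains = R_graph_walk_eigenfunctionD[OF f, unfolded nk(3)]
  define d where "d i = sqrt (chain_degree (2 * k) (3 * k) i)" for i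
  have d: "0 < d i" "U $ i = d i * f i" "U $ (3 * k + i) = d i * f (3 * k + i)" if "i < 3 * k" for i
    using that chain_degree_bounds(1)[OF that, of "2 * k"] k
      R_graph_degree[of i "2 * k" k] by (auto simp: f_def d_def nk(3))
  have even: "f (3 * k + i) = - f i" if "i < 3 * k" for i
    using even_chain_zero[OF chains(1) k \<theta>(1) _ that] \<theta>(2) by (simp add: t_def)
  then show "U $ (3 * k + i) = - U $ i" if "i < 3 * k" for i
    using d[OF that] that by simp
  define g where "g i = f i - f (3 * k + i)" for i
  have g: "chain (2 * k) (3 * k) (- 1) (cos \<theta>) g" using chains(2) by (simp add: g_def[abs_def])
  have gf: "g i = 2 * f i" if "i < 3 * k" for i using even[OF that] by (simp add: g_def)
  have pos: "0 < h i" if "chain (2 * k) (3 * k) (- 1) (cos \<theta>) h" "0 < h 0" "i < 3 * k" for h i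
    by (rule chain_positive[OF that(1) _ k _ _ that(2,3)]) (use \<theta> in \<open>auto simp: t_def\<close>)
  \<comment> \<open>A zero start would annihilate both halves of \<open>f\<close>, but
    \<open>U\<close> is nonzero.\<close>
  have "g 0 \<noteq> 0"
  proof
    assume "g 0 = 0"
    then have "f i = 0 \<and> f (3 * k + i) = 0" if "i < 3 * k" for i
      using chain_eq_zero[OF g _ _ _ that] gf[OF that] even[OF that] k by simp
    then have zero: "f i = 0" if "i < 6 * k" for i
      using that by (cases "i < 3 * k") (fastforce simp: le_iff_add not_less)+
    obtain i where "i < 2 * (2 * k + k)" "f i \<noteq> 0"
      using eigenvector_nonzero[OF U] by (auto simp: f_def)
    then show False using zero[of i] by simp
  qed
  then consider "0 < g 0" | "0 < - 1 * g 0" by linarith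
  then show "(\<forall>i<3 * k. 0 < U $ i) \<or> (\<forall>i<3 * k. U $ i < 0)"
  proof cases
    case 1
    have "0 < U $ i" if "i < 3 * k" for i
      using pos[OF g 1 that] gf[OF that] d[OF that] by simp
    then show ?thesis by blast
  next
    case 2
    have "U $ i < 0" if "i < 3 * k" for i
      using pos[OF chain_scale[OF g] 2 that] gf[OF that] d[OF that] by (simp add: mult_pos_neg)
    then show ?thesis by blast
  qed
qed

text \<open>The strict sign in \<open>R_graph_lambda2_eigenvector\<close> gives every eigenvector a
  nonzero entry at index 0, as \<open>order_char_poly_eq_1\<close> requires.\<close>

lemma R_graph_simple_lambda2:
  assumes k: "3 \<le> k"
  shows "simple_eigenvalue (normalized_laplacian (R_graph (2 * k) k))
      (lambda2 (normalized_laplacian (R_graph (2 * k) k)))"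
proof -
  have nk: "2 \<le> 2 * k + k" "2 \<le> 2 * (2 * k + k)" using k by auto
  interpret positive_degree_graph "R_graph (2 * k) k" "2 * (2 * k + k)"
    by (rule positive_degree_R_graph[OF nk(1)])
  note ev = lambda2_characterization(4)[OF nk(2) harmonic_R_graph[OF k]]
  have "Polynomial.order (lambda2 L) (char_poly L) = 1"
  proof (rule order_char_poly_eq_1[OF L_carrier L_sym ev])
    fix v assume "eigenvector L v (lambda2 L)"
    from R_graph_lambda2_eigenvector(2)[OF k this] k show "v $ 0 \<noteq> 0" by force
  qed
  with ev show ?thesis by (simp add: simple_eigenvalue_def)
qed

section \<open>Volumes and cuts in the graph \<open>R\<close>\<close>

lemma R_graph_vol_half:
  assumes "2 \<le> n + k"
  shows "vol (R_graph n k) {0..<n + k} \<le> 3 * real (n + k)"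
    and "vol (R_graph n k) {n + k..<2 * (n + k)} \<le> 3 * real (n + k)"
proof -
  let ?M = "n + k"
  have bound: "chain_degree n ?M i \<le> 3" if "i < ?M" for i
    by (rule chain_degree_bounds(2)[OF that assms])
  show "vol (R_graph n k) {0..<?M} \<le> 3 * real ?M"
    using sum_bounded_above[of "{0..<?M}" "wdegree (R_graph n k)" 3] bound
    by (simp add: vol_def R_graph_degree)
  have "wdegree (R_graph n k) i \<le> 3" if "i \<in> {?M..<2 * ?M}" for i
  proof -
    define j where "j = i - ?M"
    have "j < ?M" "i = ?M + j" using that by (auto simp: j_def)
    then show ?thesis using bound[of j] by (simp add: R_graph_degree)
  qed
  from sum_bounded_above[of "{?M..<2 * ?M}" "wdegree (R_graph n k)" 3, OF this]
  show "vol (R_graph n k) {?M..<2 * ?M} \<le> 3 * real ?M"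
    unfolding vol_def card_atLeastLessThan mult_2 by (simp add: mult.commute)
qed

lemma R_graph_cut_rungs:
  "cut (R_graph n k) {0..<n + k} {n + k..<2 * (n + k)} = real k"
proof -
  let ?M = "n + k"
  have row: "(\<Sum>j = ?M..<2 * ?M. R_graph n k $$ (i, j)) = (if n \<le> i then 1 else 0)" if i: "i < ?M" for i
  proof -
    have "(\<Sum>j = ?M..<2 * ?M. R_graph n k $$ (i, j)) = (\<Sum>j = 0..<?M. R_graph n k $$ (i, ?M + j))"
      by (rule sum_upper_half)
    also have "\<dots> = (\<Sum>j = 0..<?M. if j = i then (if n \<le> i then 1 else 0) else 0)"
      by (intro sum.cong) (use i in \<open>auto simp: R_graph_index\<close>)
    finally show ?thesis using i by simp
  qed
  have "cut (R_graph n k) {0..<?M} {?M..<2 * ?M} = (\<Sum>i = 0..<?M. if n \<le> i then 1 else 0)"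
    unfolding cut_def by (intro sum.cong refl row) simp
  also have "\<dots> = real (card ({0..<?M} \<inter> {i. n \<le> i}))"
    by (simp add: sum.If_cases)
  also have "{0..<?M} \<inter> {i. n \<le> i} = {n..<?M}" by auto
  finally show ?thesis by simp
qed

text \<open>The tail \<open>x_1, ..., x_n\<close> has degrees \<open>1, 2, ..., 2\<close>. For the
  complement it suffices to count the \<open>y\<close> tail, which has the same degrees.\<close>

lemma R_graph_vol_tails:
  assumes "1 \<le> n" "1 \<le> k"
  shows "2 * real n - 1 \<le> vol (R_graph n k) {0..<n}"
    and "2 * real n - 1 \<le> vol (R_graph n k) {n..<2 * (n + k)}"
proof -
  let ?M = "n + k"
  interpret positive_degree_graph "R_graph n k" "2 * ?M"
    by (rule positive_degree_R_graph) (use assms in simp)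
  have deg: "(if i = 0 then 1 else 2) \<le> chain_degree n ?M i" if "i < n" for i
    using that assms by (auto simp: chain_degree_def nbr_sum_def)
  have sum: "(\<Sum>i = 0..<n. if i = 0 then 1 else 2) = 2 * real n - 1"
    using assms(1) by (induction n rule: dec_induct) auto
  have "(\<Sum>i = 0..<n. if i = 0 then 1 else 2) \<le> (\<Sum>i = 0..<n. wdegree (R_graph n k) i)"
    by (rule sum_mono) (use deg in \<open>simp add: R_graph_degree\<close>)
  then show "2 * real n - 1 \<le> vol (R_graph n k) {0..<n}"
    by (simp add: sum vol_def)
  have "(\<Sum>i = 0..<n. if i = 0 then 1 else 2) \<le> (\<Sum>i = 0..<n. wdegree (R_graph n k) (?M + i))"
    by (rule sum_mono) (use deg in \<open>simp add: R_graph_degree\<close>)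
  also have "\<dots> = (\<Sum>i = ?M..<?M + n. wdegree (R_graph n k) i)"
    using sum.shift_bounds_nat_ivl[of "wdegree (R_graph n k)" 0 ?M n] by (simp add: add.commute)
  also have "\<dots> \<le> vol (R_graph n k) {n..<2 * ?M}"
    unfolding vol_def by (rule sum_mono2) (use degree_pos in \<open>auto simp: less_imp_le\<close>)
  finally show "2 * real n - 1 \<le> vol (R_graph n k) {n..<2 * ?M}"
    by (simp add: sum)
qed

text \<open>Only the edge from index \<open>n - 1\<close> to index \<open>n\<close> crosses; the
  rungs start at index \<open>n\<close>.\<close>

lemma R_graph_cut_tail:
  assumes "1 \<le> n" "1 \<le> k"
  shows "cut (R_graph n k) {0..<n} {n..<2 * (n + k)} = 1"
proof -
  have "cut (R_graph n k) {0..<n} {n..<2 * (n + k)} =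
      (\<Sum>i = 0..<n. \<Sum>j = n..<2 * (n + k). if j = n then (if i = n - 1 then 1 else 0) else 0)"
    unfolding cut_def
  proof (intro sum.cong refl)
    fix i j assume "i \<in> {0..<n}" "j \<in> {n..<2 * (n + k)}"
    then show "R_graph n k $$ (i, j) = (if j = n then (if i = n - 1 then 1 else 0) else 0)"
      using assms by (subst R_graph_entry) auto
  qed
  also have "\<dots> = 1" using assms by simp
  finally show ?thesis .
qed

lemma R_graph_Mcut_lt:
  assumes k: "3 \<le> k"
  shows "Mcut (R_graph (2 * k) k) < Ncut (R_graph (2 * k) k) {0..<3 * k} {3 * k..<6 * k}"
proof -
  let ?R = "R_graph (2 * k) k"
  define K where "K = real k"
  have K: "3 \<le> K" using k by (simp add: K_def)
  have nk: "2 \<le> 2 * k + k" "1 \<le> 2 * k" "1 \<le> k" "2 * k + k = 3 * k" "2 * (2 * k + k) = 6 * k"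
    using k by auto
  interpret positive_degree_graph ?R "2 * (2 * k + k)"
    by (rule positive_degree_R_graph[OF nk(1)])
  have V: "verts ?R - {0..<2 * k} = {2 * k..<6 * k}"
    by (auto simp: verts_def)
  have "Mcut ?R \<le> Ncut ?R {0..<2 * k} {2 * k..<6 * k}"
    unfolding V[symmetric] by (rule Mcut_le) (use k in \<open>auto simp: verts_def\<close>)
  also have "\<dots> = 1 / vol ?R {0..<2 * k} + 1 / vol ?R {2 * k..<6 * k}"
    using R_graph_cut_tail[OF nk(2,3)] by (simp add: Ncut_def nk(5))
  also have "\<dots> \<le> 1 / (4 * K - 1) + 1 / (4 * K - 1)"
    using R_graph_vol_tails[OF nk(2,3)] K
    by (intro add_mono divide_left_mono mult_pos_pos) (auto simp: nk(5) K_def)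
  also have "\<dots> < 2 / 9"
    using K by (simp add: field_simps)
  \<comment> \<open>The cut severs \<open>K\<close> rungs, and each half has \<open>3 k\<close>
    vertices of degree at most 3, hence volume at most \<open>9 K\<close>.\<close>
  also have "2 / 9 = K * (1 / (9 * K) + 1 / (9 * K))"
    using K by simp
  also have "\<dots> \<le> K * (1 / vol ?R {0..<3 * k} + 1 / vol ?R {3 * k..<6 * k})"
  proof (intro mult_left_mono add_mono divide_left_mono mult_pos_pos)
    show "vol ?R {0..<3 * k} \<le> 9 * K" "vol ?R {3 * k..<6 * k} \<le> 9 * K"
      using R_graph_vol_half[OF nk(1)] by (auto simp: nk(4,5) K_def)
    show "0 < vol ?R {0..<3 * k}" "0 < vol ?R {3 * k..<6 * k}"
      unfolding vol_def by (rule sum_pos; use k degree_pos in auto)+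
  qed (use K in auto)
  also have "\<dots> = Ncut ?R {0..<3 * k} {3 * k..<6 * k}"
    using R_graph_cut_rungs[of "2 * k" k] by (simp add: Ncut_def nk(4,5) K_def)
  finally show ?thesis .
qed

text \<open>No entry of \<open>U\<close> is 0 and the two halves have opposite signs, so the
  spectral cut separates all \<open>x_i\<close> from all \<open>y_i\<close>. If the \<open>x\<close>
  half is the negative one, \<open>Ncut_commute\<close> swaps the sides.\<close>

lemma R_graph_Mcut_lt_Lcut:
  assumes k: "3 \<le> k"
    and U: "eigenvector (normalized_laplacian (R_graph (2 * k) k)) U
      (lambda2 (normalized_laplacian (R_graph (2 * k) k)))"
  shows "Mcut (R_graph (2 * k) k) < Ncut (R_graph (2 * k) k) (Vpos U \<union> Vzero U) (Vneg U)"
proof -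
  have nk: "2 \<le> 2 * k + k" using k by auto
  interpret positive_degree_graph "R_graph (2 * k) k" "2 * (2 * k + k)"
    by (rule positive_degree_R_graph[OF nk])
  have dim: "dim_vec U = 6 * k"
    using U L_carrier by (auto simp: eigenvector_def)
  note odd = R_graph_lambda2_eigenvector(1)[OF k U]
  have y: "U $ i = - U $ (i - 3 * k)" "i - 3 * k < 3 * k" if "3 * k \<le> i" "i < 6 * k" for i
    using odd[of "i - 3 * k"] that by auto
  have rest: "Vpos U \<union> Vzero U = {0..<6 * k} - Vneg U"
    unfolding Vpos_def Vzero_def Vneg_def dim by auto
  from R_graph_lambda2_eigenvector(2)[OF k U] show ?thesis
  proof
    assume pos: "\<forall>i<3 * k. 0 < U $ i"
    have "U $ i < 0 \<longleftrightarrow> 3 * k \<le> i" if "i < 6 * k" for i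
      using pos[rule_format, of i] pos[rule_format, of "i - 3 * k"] y[of i] that
      by (cases "i < 3 * k") auto
    then have "Vneg U = {3 * k..<6 * k}"
      unfolding Vneg_def dim by auto
    moreover from this have "Vpos U \<union> Vzero U = {0..<3 * k}"
      unfolding rest by auto
    ultimately show ?thesis using R_graph_Mcut_lt[OF k] by simp
  next
    assume neg: "\<forall>i<3 * k. U $ i < 0"
    have "U $ i < 0 \<longleftrightarrow> i < 3 * k" if "i < 6 * k" for i
      using neg[rule_format, of i] neg[rule_format, of "i - 3 * k"] y[of i] that
      by (cases "i < 3 * k") auto
    then have "Vneg U = {0..<3 * k}"
      unfolding Vneg_def dim by auto
    moreover from this have "Vpos U \<union> Vzero U = {3 * k..<6 * k}"
      unfolding rest by auto
    ultimately show ?thesis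
      using R_graph_Mcut_lt[OF k] Ncut_commute[of "{0..<3 * k}" "{3 * k..<6 * k}"] by simp
  qed
qed

lemma R_graph_lambda2_eigenvector_odd:
  assumes k: "3 \<le> k"
    and U: "eigenvector (normalized_laplacian (R_graph (2 * k) k)) U
      (lambda2 (normalized_laplacian (R_graph (2 * k) k)))"
  shows "odd_vector (2 * k) k U"
  unfolding odd_vector_def
proof (intro allI impI)
  fix i assume i: "1 \<le> i \<and> i \<le> 2 * k + k"
  then have "yv (2 * k) k i = 3 * k + (i - 1)" "xv i = i - 1" "i - 1 < 3 * k"
    by (auto simp: yv_def xv_def)
  then show "U $ yv (2 * k) k i = - (U $ xv i)"
    using R_graph_lambda2_eigenvector(1)[OF k U, of "i - 1"] by simp
qed

theorem theorem7:
  fixes k :: nat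
  assumes "k \<ge> 3"
  shows "(lambda2 (normalized_laplacian (path_graph (4 * k)))
           < lambda2 (normalized_laplacian (P_graph (2 * k) k)))
    \<and> (lambda2 (normalized_laplacian (R_graph (2 * k) k))
           < lambda2 (normalized_laplacian (path_graph (4 * k))))
    \<and> (\<forall>U. eigenvector (normalized_laplacian (R_graph (2 * k) k)) U
                (lambda2 (normalized_laplacian (R_graph (2 * k) k)))
           \<longrightarrow> odd_vector (2 * k) k U)
    \<and> (simple_eigenvalue (normalized_laplacian (R_graph (2 * k) k))
           (lambda2 (normalized_laplacian (R_graph (2 * k) k))))
    \<and> (\<forall>U. eigenvector (normalized_laplacian (R_graph (2 * k) k)) U
                (lambda2 (normalized_laplacian (R_graph (2 * k) k)))
           \<longrightarrow> Mcut (R_graph (2 * k) k)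
                 < Ncut (R_graph (2 * k) k) (Vpos U \<union> Vzero U) (Vneg U))"
proof -
  have path: "lambda2 (normalized_laplacian (path_graph (4 * k))) = 1 - cos (pi / real (4 * k - 1))"
    by (rule lambda2_path_graph) (use assms in simp)
  show ?thesis
    unfolding path
    using lambda2_P_graph_gt[OF assms] lambda2_R_graph_lt[OF assms]
      R_graph_lambda2_eigenvector_odd[OF assms] R_graph_simple_lambda2[OF assms]
      R_graph_Mcut_lt_Lcut[OF assms] by blast
qed

end
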